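(* Let $0<\varepsilon<2$ be real, and let $M=\lfloor 2/\varepsilon\rfloor$. Define $$\rho_M=\begin{cases}1, & M=1,\\[2pt] \dfrac32, & 2\le M\le 5,\\[5pt] \dfrac{11}{6}, & M=6,\\[6pt] \dfrac M4+\dfrac{3}{4M}, & M\ge 7\text{ and } M \text{ is odd},\\[8pt] \dfrac M4+\dfrac 2M, & M\ge 8\text{ and } M\text{ is even}.\end{cases}$$ If $G$ is a graph on $n\ge 1$ vertices with $\operatorname{mad}(G)\le 2-\varepsilon$, then $$\operatorname{diam} R_3(G)\le \rho_M\, n.$$ Moreover, for every fixed $\varepsilon\in(0,2)$, equality holds for infinitely many values of $n$; that is, there are infinitely many $n$ for which there exists a graph $G$ on $n$ vertices with $\operatorname{mad}(G)\le 2-\varepsilon$ and $\operatorname{diam} R_3(G)=\rho_M n$.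
   Context: All graphs are finite and simple. The maximum average degree of a graph $G$ is $\operatorname{mad}(G)=\max_{\emptyset\ne H\subseteq G}\frac{2|E(H)|}{|V(H)|}$, the maximum over nonempty subgraphs $H$ of $G$. A proper $3$-coloring of $G$ is a map $\varphi:V(G)\to\{1,2,3\}$ giving adjacent vertices distinct colors. The reconfiguration graph $R_3(G)$ is the graph whose vertices are the proper $3$-colorings of $G$, two colorings being adjacent if and only if they differ at exactly one vertex of $G$. $\operatorname{diam}$ denotes the diameter of a graph, with $\operatorname{diam}=\infty$ for a disconnected graph. *)

theory Defs
  imports Complex_Main "HOL-Library.FuncSet" "Graph_Theory.Graph_Theory"
begin

text \<open>
  A finite simple graph is a symmetric, loop-free, finite digraph without parallel arcs
  (locale \<^locale>\<open>pair_graph\<close>). Every undirected edge is represented by two opposite arcs,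
  so the edges proper are the unordered pairs below.
\<close>

definition edges :: "'a pair_pre_digraph \<Rightarrow> 'a set set" where
  "edges G = (\<lambda>(u, v). {u, v}) ` parcs G"

text \<open>
  The library notion \<^const>\<open>subgraph\<close> also admits asymmetric subdigraphs, hence the
  condition \<^term>\<open>pair_graph H\<close>. For a finite simple graph with at least one vertex,
  the set is finite and nonempty, so \<^const>\<open>Max\<close> is meaningful.
\<close>

definition mad :: "'a pair_pre_digraph \<Rightarrow> real" where
  "mad G = Max {2 * real (card (edges H)) / real (card (pverts H)) | H.
     pair_graph H \<and> subgraph (with_proj H) (with_proj G) \<and> pverts H \<noteq> {}}"

text \<open>
  Colourings are extensional functions on the vertex set, so that each colouring of the
  graph is represented by exactly one function.
\<close>

definition proper_3_colorings :: "'a pair_pre_digraph \<Rightarrow> ('a \<Rightarrow> nat) set" where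
  "proper_3_colorings G =
     {\<phi> \<in> pverts G \<rightarrow>\<^sub>E {1, 2, 3}. \<forall>(u, v) \<in> parcs G. \<phi> u \<noteq> \<phi> v}"

definition reconfiguration_graph :: "'a pair_pre_digraph \<Rightarrow> ('a \<Rightarrow> nat) pair_pre_digraph" where
  "reconfiguration_graph G =
     \<lparr> pverts = proper_3_colorings G,
       parcs = {(\<phi>, \<psi>). \<phi> \<in> proper_3_colorings G \<and> \<psi> \<in> proper_3_colorings G \<and>
                  (\<exists>!v. v \<in> pverts G \<and> \<phi> v \<noteq> \<psi> v)} \<rparr>"

lemma pair_graph_reconfiguration_graph:
  assumes "pair_graph G"
  shows "pair_graph (reconfiguration_graph G)"
proof -
  interpret pair_graph G by fact
  have fin: "finite (proper_3_colorings G)"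
    unfolding proper_3_colorings_def
    by (rule finite_subset[of _ "pverts G \<rightarrow>\<^sub>E {1, 2, 3}"]) (auto intro!: finite_PiE pair_finite_verts)
  have "finite (parcs (reconfiguration_graph G))"
    by (rule finite_subset[of _ "proper_3_colorings G \<times> proper_3_colorings G"])
       (auto simp: reconfiguration_graph_def fin)
  moreover have "sym (parcs (reconfiguration_graph G))"
    unfolding sym_def reconfiguration_graph_def by (auto simp: eq_commute)
  ultimately show ?thesis
    using fin by unfold_locales (auto simp: reconfiguration_graph_def symmetric_def)
qed

text \<open>
  The distance of two vertices is the library's shortest-path cost \<^const>\<open>wf_digraph.\<mu>\<close>
  for unit arc weights. It is \<^term>\<open>\<infinity> :: ereal\<close> if there is no walk, so the diameter of a
  disconnected graph is \<^term>\<open>\<infinity> :: ereal\<close>.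
\<close>

definition graph_diameter :: "'a pair_pre_digraph \<Rightarrow> ereal" where
  "graph_diameter G =
     (SUP u \<in> pverts G. SUP v \<in> pverts G. wf_digraph.\<mu> (with_proj G) (\<lambda>_. 1) u v)"

text \<open>Only used for \<open>M \<ge> 1\<close>; the last case is that of even \<open>M \<ge> 8\<close>.\<close>

definition rho :: "nat \<Rightarrow> real" where
  "rho M =
     (if M = 1 then 1
      else if 2 \<le> M \<and> M \<le> 5 then 3 / 2
      else if M = 6 then 11 / 6
      else if odd M then real M / 4 + 3 / (4 * real M)
      else real M / 4 + 2 / real M)"

end

theory Submission
  imports Defs
begin

text \<open>
  If \<open>mad G \<le> 2 - \<epsilon>\<close>, then \<open>G\<close> is a forest all of whose components have at most \<open>M\<close> vertices.
  A 3-colouring of a forest lifts to a height function \<open>h\<close> into the integers that changes by exactly 1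
  along every edge and whose residue modulo 3 is the colour (minus 1). Recolouring a vertex changes its height by
  \<open>\<plusminus>2\<close>, and as long as two lifts of the same parity differ, an extremal vertex among
  those where one is too high (or too low) can be moved towards the other one. So the distance of two colourings
  is the minimum of \<open>\<Sum> \<bar>h v - g v\<bar> / 2\<close> over lifts of the same parity, where
  \<open>g\<close> may be changed by a multiple of 6 on every component.

  On a component with \<open>m\<close> vertices the numbers \<open>(h v - g v) / 2\<close>, in sorted order, form a sequence of
  integers with steps 0 or 1, and every such sequence occurs on a path. The question becomes how far such a
  sequence can be from the nearest constant sequence with a value in \<open>3 * \<int>\<close>. Choosing the multiple
  of 3 next to the median gives the upper bound, and \<open>m\<close> consecutive integers around 1 or 3/2 attain it
  in the cases needed. Equality in the theorem is attained by disjoint unions of equal paths.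
\<close>

section \<open>Integer sequences with steps 0 or 1\<close>

definition gentle :: "nat \<Rightarrow> (nat \<Rightarrow> int) \<Rightarrow> bool" where
  "gentle m x \<longleftrightarrow> (\<forall>i. Suc i < m \<longrightarrow> x i \<le> x (Suc i) \<and> x (Suc i) \<le> x i + 1)"

lemma gentle_step:
  assumes "gentle m x" "Suc i < m"
  shows "x (Suc i) = x i \<or> x (Suc i) = x i + 1"
  using assms unfolding gentle_def by (metis order_antisym zle_add1_eq_le order_le_less)

lemma gentle_bounds:
  assumes "gentle m x" "i < m"
  shows "x 0 \<le> x i \<and> x i \<le> x 0 + int i"
  using assms(2)
proof (induction i)
  case (Suc i)
  with assms(1) have "x i \<le> x (Suc i) \<and> x (Suc i) \<le> x i + 1"
    by (auto simp: gentle_def)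
  with Suc show ?case by auto
qed simp

lemma gentle_shift: "gentle (Suc m) x \<Longrightarrow> gentle m (\<lambda>i. x (Suc i))"
  by (auto simp: gentle_def)

lemma gentle_upper:
  assumes "gentle m x" "c \<le> m"
  shows "gentle (m - c) (\<lambda>j. x (c + j) - t)"
  using assms by (auto simp: gentle_def)

text \<open>Read away from the cut with reversed sign, the lower part is increasing again, so both
  parts of a sequence fall under the same one-sided bounds.\<close>

lemma gentle_lower:
  assumes "gentle m x" "c \<le> m"
  shows "gentle c (\<lambda>j. t - x (c - Suc j))"
  unfolding gentle_def
proof (intro allI impI)
  fix j assume "Suc j < c"
  then have "Suc (c - Suc (Suc j)) = c - Suc j" "Suc (c - Suc (Suc j)) < m"
    using assms(2) by auto
  with assms(1) show "t - x (c - Suc j) \<le> t - x (c - Suc (Suc j)) \<and>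
      t - x (c - Suc (Suc j)) \<le> t - x (c - Suc j) + 1"
    unfolding gentle_def by (metis add.commute diff_add_eq diff_left_mono le_diff_eq
        diff_le_eq add_diff_eq)
qed

lemma sum_lessThan_add:
  fixes f :: "nat \<Rightarrow> 'b :: comm_monoid_add"
  shows "(\<Sum>i<a + b. f i) = (\<Sum>i<a. f i) + (\<Sum>j<b. f (a + j))"
  by (induction b) (simp_all add: add.assoc)

lemma sum_split_at:
  fixes x :: "nat \<Rightarrow> int"
  assumes "c \<le> m"
  shows "(\<Sum>i<m. \<bar>x i - t\<bar>) = (\<Sum>j<c. \<bar>t - x (c - Suc j)\<bar>) + (\<Sum>j<m - c. \<bar>x (c + j) - t\<bar>)"
proof -
  have "(\<Sum>i<m. \<bar>x i - t\<bar>) = (\<Sum>i<c + (m - c). \<bar>x i - t\<bar>)"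
    using assms by simp
  also have "\<dots> = (\<Sum>i<c. \<bar>x i - t\<bar>) + (\<Sum>j<m - c. \<bar>x (c + j) - t\<bar>)"
    by (rule sum_lessThan_add)
  also have "(\<Sum>i<c. \<bar>x i - t\<bar>) = (\<Sum>j<c. \<bar>t - x (c - Suc j)\<bar>)"
    by (subst sum.nat_diff_reindex[symmetric]) (simp add: abs_minus_commute)
  finally show ?thesis .
qed

section \<open>Upper bounds for the distance of a gentle sequence to the multiples of 3\<close>

lemma sum_gentle_nonneg:
  assumes "gentle n y" "n \<ge> 1 \<Longrightarrow> 0 \<le> y 0" "n \<ge> 1 \<Longrightarrow> y 0 \<le> v"
  shows "2 * (\<Sum>i<n. \<bar>y i\<bar>) \<le> 2 * int n * v + int n * (int n - 1)"
proof -
  have "(\<Sum>i<n. \<bar>y i\<bar>) \<le> (\<Sum>i<n. v + int i)"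
  proof (rule sum_mono)
    fix i assume "i \<in> {..<n}"
    with gentle_bounds[OF assms(1), of i] assms(2,3) show "\<bar>y i\<bar> \<le> v + int i" by auto
  qed
  moreover have "2 * (\<Sum>i<n. v + int i) = 2 * int n * v + int n * (int n - 1)"
    by (induction n) (auto simp: algebra_simps)
  ultimately show ?thesis by linarith
qed

text \<open>Two extremes compete: staying at -1 throughout, with sum \<open>n\<close>, and climbing
  at once through -1, 0, ..., n - 2, with sum \<open>1 + (n - 1) * (n - 2) / 2\<close>. Peeling off
  the first entry leaves the same situation or a start at 0.\<close>

lemma sum_gentle_from_minus_one:
  assumes "gentle n y" "y 0 = -1" "n \<ge> 1"
  shows "2 * (\<Sum>i<n. \<bar>y i\<bar>) \<le> max (2 * int n) (2 + (int n - 1) * (int n - 2))"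
  using assms
proof (induction n arbitrary: y)
  case (Suc n)
  let ?S = "\<Sum>i<n. \<bar>y (Suc i)\<bar>"
  have sum: "(\<Sum>i<Suc n. \<bar>y i\<bar>) = 1 + ?S"
    using Suc.prems(2) by (simp add: sum.lessThan_Suc_shift del: sum.lessThan_Suc)
  have g: "gentle n (\<lambda>i. y (Suc i))" using Suc.prems(1) by (rule gentle_shift)
  consider "n = 0" | "n \<ge> 1" "y 1 = -1" | "n \<ge> 1" "y 1 = 0"
    using gentle_step[OF Suc.prems(1), of 0] Suc.prems(2) by fastforce
  then show ?case
  proof cases
    case 1
    then show ?thesis using Suc.prems(2) by simp
  next
    case 2
    have "2 * ?S \<le> max (2 * int n) (2 + (int n - 1) * (int n - 2))"
      using Suc.IH[OF g] 2 by simp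
    moreover have "2 + (2 + (int n - 1) * (int n - 2)) \<le> max (2 * int (Suc n)) (2 + (int (Suc n) - 1) * (int (Suc n) - 2))"
    proof (cases "n \<le> 2")
      case True
      then have "n = 1 \<or> n = 2" using 2 by auto
      then show ?thesis by auto
    next
      case False
      then have "2 + (2 + (int n - 1) * (int n - 2)) \<le> 2 + (int (Suc n) - 1) * (int (Suc n) - 2)"
        by (simp add: algebra_simps)
      then show ?thesis by simp
    qed
    ultimately show ?thesis unfolding sum by (simp add: max_def split: if_splits)
  next
    case 3
    have "2 * ?S \<le> int n * (int n - 1)"
      using sum_gentle_nonneg[OF g, of 0] 3 by simp
    then show ?thesis unfolding sum by (simp add: max_def)
  qed
qed simp

text \<open>Reversal with negation preserves the multiples of 3 and exchanges the residues 1 and -1,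
  so only one of these two residues has to be treated directly.\<close>

lemma gentle_reflect:
  assumes "gentle m x"
  shows "gentle m (\<lambda>i. - x (m - Suc i))"
  using gentle_lower[OF assms order_refl, of 0] by simp

lemma sum_reflect:
  fixes x :: "nat \<Rightarrow> int"
  shows "(\<Sum>i<m. \<bar>- x (m - Suc i) - t\<bar>) = (\<Sum>i<m. \<bar>x i - - t\<bar>)"
  by (subst sum.nat_diff_reindex[symmetric]) (auto intro!: sum.cong)

text \<open>The cut just after the median makes the lower half start at 0 or -1 and the upper half
  start at most 1 above the median. The bound is \<open>(m ^ 2 + 3) / 4\<close> for
  \<open>m = 2 * c + 1\<close>.\<close>

lemma gentle_odd_aux:
  assumes g: "gentle (2 * c + 1) x" and c: "c \<ge> 3" and x: "x c = t \<or> x c = t + 1"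
  shows "(\<Sum>i<2 * c + 1. \<bar>x i - t\<bar>) \<le> int c ^ 2 + int c + 1"
proof -
  let ?l = "\<lambda>j. t - x (Suc c - Suc j)" and ?u = "\<lambda>j. x (Suc c + j) - t"
  have gl: "gentle (Suc c) ?l" using gentle_lower[OF g, of "Suc c" t] by simp
  have gu: "gentle c ?u" using gentle_upper[OF g, of "Suc c" t] c by simp
  have sum: "(\<Sum>i<2 * c + 1. \<bar>x i - t\<bar>) = (\<Sum>j<Suc c. \<bar>?l j\<bar>) + (\<Sum>j<c. \<bar>?u j\<bar>)"
    using sum_split_at[of "Suc c" "2 * c + 1" x t] c by simp
  have u0: "x c - t \<le> ?u 0" "?u 0 \<le> x c - t + 1"
    using g c by (auto simp: gentle_def)
  have U: "2 * (\<Sum>j<c. \<bar>?u j\<bar>) \<le> 2 * int c * (x c - t + 1) + int c * (int c - 1)"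
    by (rule sum_gentle_nonneg[OF gu]) (use u0 x in auto)
  from x show ?thesis
  proof
    assume x: "x c = t"
    have "2 * (\<Sum>j<Suc c. \<bar>?l j\<bar>) \<le> 2 * int (Suc c) * 0 + int (Suc c) * (int (Suc c) - 1)"
      by (rule sum_gentle_nonneg[OF gl]) (use x in auto)
    then show ?thesis using U x unfolding sum by (simp add: algebra_simps power2_eq_square)
  next
    assume x: "x c = t + 1"
    have "2 * (\<Sum>j<Suc c. \<bar>?l j\<bar>) \<le> max (2 * int (Suc c)) (2 + (int (Suc c) - 1) * (int (Suc c) - 2))"
      by (rule sum_gentle_from_minus_one[OF gl]) (use x in auto)
    \<comment> \<open>For \<open>c \<ge> 3\<close> the climbing extreme of the lower half dominates
      the constant one.\<close>
    moreover have "2 * int (Suc c) \<le> 2 + int c * (int c - 1)"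
      using mult_left_mono[of 2 "int c - 1" "int c"] c by (simp add: algebra_simps)
    ultimately have "2 * (\<Sum>j<Suc c. \<bar>?l j\<bar>) \<le> 2 + int c * (int c - 1)" by simp
    then show ?thesis using U x unfolding sum by (simp add: algebra_simps power2_eq_square)
  qed
qed

text \<open>Every integer is within 1 of a multiple of 3; a median just below one is
  reflected.\<close>

lemma gentle_odd:
  assumes g: "gentle (2 * c + 1) x" and c: "c \<ge> 3"
  shows "\<exists>k. (\<Sum>i<2 * c + 1. \<bar>x i - 3 * k\<bar>) \<le> int c ^ 2 + int c + 1"
proof -
  obtain k where "x c = 3 * k \<or> x c = 3 * k + 1 \<or> x c = 3 * k - 1"
  proof -
    have "\<exists>k. x c = 3 * k \<or> x c = 3 * k + 1 \<or> x c = 3 * k - 1" by presburger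
    then show ?thesis using that by blast
  qed
  then consider "x c = 3 * k \<or> x c = 3 * k + 1" | "- x c = 3 * (-k) + 1" by auto
  then show ?thesis
  proof cases
    case 1
    then show ?thesis using gentle_odd_aux[OF g c] by blast
  next
    case 2
    have "(\<Sum>i<2 * c + 1. \<bar>- x (2 * c + 1 - Suc i) - 3 * (-k)\<bar>) \<le> int c ^ 2 + int c + 1"
      by (rule gentle_odd_aux[OF gentle_reflect[OF g] c]) (use 2 in simp)
    then show ?thesis unfolding sum_reflect by auto
  qed
qed

text \<open>The cut lies between the two middle entries. The bound is \<open>(m ^ 2 + 8) / 4\<close>
  for \<open>m = 2 * c\<close>; consecutive integers with middle entries \<open>t + 1\<close> and
  \<open>t + 2\<close> attain it.\<close>

lemma gentle_even_aux:
  assumes g: "gentle (2 * c) x" and c: "c \<ge> 3"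
    and x: "x (c - 1) = t \<or> x (c - 1) = t + 1 \<and> (x c = t + 1 \<or> c \<ge> 4)"
  shows "(\<Sum>i<2 * c. \<bar>x i - t\<bar>) \<le> int c ^ 2 + 2"
proof -
  let ?l = "\<lambda>j. t - x (c - Suc j)" and ?u = "\<lambda>j. x (c + j) - t"
  have gl: "gentle c ?l" using gentle_lower[OF g, of c t] by simp
  have gu: "gentle c ?u" using gentle_upper[OF g, of c t] c by simp
  have sum: "(\<Sum>i<2 * c. \<bar>x i - t\<bar>) = (\<Sum>j<c. \<bar>?l j\<bar>) + (\<Sum>j<c. \<bar>?u j\<bar>)"
    using sum_split_at[of c "2 * c" x t] c by simp
  have "Suc (c - 1) = c" "Suc (c - 1) < 2 * c" using c by auto
  then have u0: "x (c - 1) - t \<le> ?u 0" "?u 0 \<le> x (c - 1) - t + 1"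
    using g unfolding gentle_def by (metis add.right_neutral diff_right_mono,
      metis add.right_neutral diff_add_eq diff_right_mono)
  have U: "2 * (\<Sum>j<c. \<bar>?u j\<bar>) \<le> 2 * int c * (?u 0) + int c * (int c - 1)"
    by (rule sum_gentle_nonneg[OF gu]) (use u0 x in auto)
  from x show ?thesis
  proof (elim disjE conjE)
    assume x: "x (c - 1) = t"
    have "2 * (\<Sum>j<c. \<bar>?l j\<bar>) \<le> 2 * int c * 0 + int c * (int c - 1)"
      by (rule sum_gentle_nonneg[OF gl]) (use x in auto)
    moreover have "int c * ?u 0 \<le> int c * 1"
      by (rule mult_left_mono) (use u0 x in auto)
    ultimately show ?thesis using U unfolding sum by (simp add: algebra_simps power2_eq_square)
  next
    assume x: "x (c - 1) = t + 1" "x c = t + 1"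
    have "2 * (\<Sum>j<c. \<bar>?l j\<bar>) \<le> max (2 * int c) (2 + (int c - 1) * (int c - 2))"
      by (rule sum_gentle_from_minus_one[OF gl]) (use x c in auto)
    \<comment> \<open>With a name for the square, the rest is linear arithmetic in \<open>s\<close>
      and \<open>c\<close>.\<close>
    moreover obtain s where s: "int c * int c = s" by blast
    moreover have "3 * int c \<le> s"
      unfolding s[symmetric] by (rule mult_right_mono) (use c in auto)
    moreover have "3 \<le> int c" using c by simp
    ultimately show ?thesis using U x unfolding sum
      by (simp add: algebra_simps power2_eq_square max_def split: if_splits)
  next
    assume x: "x (c - 1) = t + 1" and c4: "c \<ge> 4"
    have "2 * (\<Sum>j<c. \<bar>?l j\<bar>) \<le> max (2 * int c) (2 + (int c - 1) * (int c - 2))"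
      by (rule sum_gentle_from_minus_one[OF gl]) (use x c in auto)
    moreover obtain s where s: "int c * int c = s" by blast
    \<comment> \<open>This is \<open>(c - 1) * (c - 4) \<ge> 0\<close>: even a lower half that is
      constantly \<open>t + 1\<close> stays within the bound. It fails for \<open>c = 3\<close>,
      hence the separate treatment of six terms.\<close>
    moreover have "5 * int c \<le> s + 4"
      using mult_nonneg_nonneg[of "int c - 1" "int c - 4"] c4 s by (simp add: algebra_simps)
    moreover have "int c * ?u 0 \<le> int c * 2"
      by (rule mult_left_mono) (use u0 x in auto)
    moreover have "4 \<le> int c" using c4 by simp
    ultimately show ?thesis using U unfolding sum
      by (simp add: algebra_simps power2_eq_square max_def split: if_splits)
  qed
qed

text \<open>
  For six terms the multiple of 3 nearest to the median need not suffice: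
  \<open>1, 1, 1, 2, 3, 4\<close> has distance 12 from 0, but 8 from 3.
\<close>

lemma gentle_six:
  assumes g: "gentle 6 x" and "x 2 = t + 1" "x 3 = t + 2"
  shows "(\<Sum>i<6. \<bar>x i - t\<bar>) \<le> 11 \<or> (\<Sum>i<6. \<bar>x i - (t + 3)\<bar>) \<le> 11"
proof -
  have a: "x 1 = t \<or> x 1 = t + 1"
    using gentle_step[OF g, of 1] assms(2) by (auto simp: eval_nat_numeral)
  then have b: "x 0 = t - 1 \<or> x 0 = t \<or> x 0 = t + 1"
    using gentle_step[OF g, of 0] by auto
  have c: "x 4 = t + 2 \<or> x 4 = t + 3"
    using gentle_step[OF g, of 3] assms(3) by (auto simp: eval_nat_numeral)
  then have d: "x 5 = t + 2 \<or> x 5 = t + 3 \<or> x 5 = t + 4"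
    using gentle_step[OF g, of 4] by (auto simp: eval_nat_numeral)
  have sum: "(\<Sum>i<6. \<bar>x i - u\<bar>) = \<bar>x 0 - u\<bar> + \<bar>x 1 - u\<bar> + \<bar>x 2 - u\<bar> + \<bar>x 3 - u\<bar> + \<bar>x 4 - u\<bar> + \<bar>x 5 - u\<bar>" for u
    by (simp add: eval_nat_numeral)
  from a b c d show ?thesis unfolding sum assms(2,3)
    by (elim disjE) simp_all
qed

lemma gentle_even:
  assumes g: "gentle (2 * c) x" and c: "c \<ge> 3"
  shows "\<exists>k. (\<Sum>i<2 * c. \<bar>x i - 3 * k\<bar>) \<le> int c ^ 2 + 2"
proof -
  have "Suc (c - 1) = c" "Suc (c - 1) < 2 * c" using c by auto
  then have s: "x (c - 1) \<le> x c \<and> x c \<le> x (c - 1) + 1"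
    using g unfolding gentle_def by metis
  \<comment> \<open>Reflection negates the two middle entries and swaps them, so this is the
    hypothesis of \<open>gentle_even_aux\<close> for the mirrored sequence.\<close>
  have refl: ?thesis if "- x c = 3 * k \<or> - x c = 3 * k + 1 \<and> - x (c - 1) = 3 * k + 1" for k
  proof -
    have "2 * c - Suc (c - 1) = c" "2 * c - Suc c = c - 1" using c by auto
    then have "(\<Sum>i<2 * c. \<bar>- x (2 * c - Suc i) - 3 * k\<bar>) \<le> int c ^ 2 + 2"
      by (intro gentle_even_aux[OF gentle_reflect[OF g] c]) (use that in auto)
    then show ?thesis unfolding sum_reflect by (metis mult_minus_right)
  qed
  have "\<exists>k. x (c - 1) = 3 * k \<or> x (c - 1) = 3 * k + 1 \<or> x (c - 1) = 3 * k - 1" by presburger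
  then obtain k where "x (c - 1) = 3 * k \<or> x (c - 1) = 3 * k + 1 \<or> x (c - 1) = 3 * k - 1" by blast
  \<comment> \<open>Up to reflection the left middle entry is \<open>3 * k\<close> or
    \<open>3 * k + 1\<close>. Only the middle entries \<open>3 * k + 1\<close>,
    \<open>3 * k + 2\<close> with \<open>c = 3\<close> escape
    \<open>gentle_even_aux\<close>.\<close>
  with s consider "x (c - 1) = 3 * k" | "x (c - 1) = 3 * k + 1" "x c = 3 * k + 1 \<or> c \<ge> 4"
    | "- x c = 3 * (-k)"
    | "- x c = 3 * (-k) + 1" "- x (c - 1) = 3 * (-k) + 1"
    | "c = 3" "x (c - 1) = 3 * k + 1" "x c = 3 * k + 2"
    using c by linarith
  then show ?thesis
  proof cases
    case 5
    then have "(\<Sum>i<6. \<bar>x i - 3 * k\<bar>) \<le> 11 \<or> (\<Sum>i<6. \<bar>x i - 3 * (k + 1)\<bar>) \<le> 11"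
      using gentle_six[of x "3 * k"] g by (simp add: algebra_simps)
    then have "\<exists>k. (\<Sum>i<6. \<bar>x i - 3 * k\<bar>) \<le> 11" by blast
    then show ?thesis using 5(1) by simp
  qed (use gentle_even_aux[OF g c] refl in blast)+
qed

text \<open>An entry between \<open>3 * k\<close> and \<open>3 * k + 3\<close> has distances to the
  two ends adding up to 3, which explains the average 3/2. Larger entries can occur as well, so all
  step patterns are checked.\<close>

lemma gentle_small:
  assumes g: "gentle m x" and m: "m \<le> 5"
  shows "\<exists>k. 2 * (\<Sum>i<m. \<bar>x i - 3 * k\<bar>) \<le> 3 * int m"
proof -
  have "\<exists>k. x 0 = 3 * k \<or> x 0 = 3 * k + 1 \<or> x 0 = 3 * k + 2" by presburger
  then obtain k where x0: "x 0 = 3 * k \<or> x 0 = 3 * k + 1 \<or> x 0 = 3 * k + 2" by blast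
  have x1: "x 1 = x 0 \<or> x 1 = x 0 + 1" if "m > 1"
    using gentle_step[OF g, of 0] that by simp
  have x2: "x 2 = x 1 \<or> x 2 = x 1 + 1" if "m > 2"
    using gentle_step[OF g, of 1] that by (simp add: eval_nat_numeral)
  have x3: "x 3 = x 2 \<or> x 3 = x 2 + 1" if "m > 3"
    using gentle_step[OF g, of 2] that by (simp add: eval_nat_numeral)
  have x4: "x 4 = x 3 \<or> x 4 = x 3 + 1" if "m > 4"
    using gentle_step[OF g, of 3] that by (simp add: eval_nat_numeral)
  let ?S = "\<lambda>u. \<Sum>i<m. \<bar>x i - u\<bar>"
  have "2 * ?S (3 * k) \<le> 3 * int m \<or> 2 * ?S (3 * k + 3) \<le> 3 * int m"
  proof -
    consider "m = 0" | "m = 1" | "m = 2" | "m = 3" | "m = 4" | "m = 5" using m by linarith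
    then show ?thesis
    proof cases
      case 1
      then show ?thesis by simp
    next
      case 2
      have S: "?S u = \<bar>x 0 - u\<bar>" for u using 2 by simp
      show ?thesis unfolding S using x0 2 by (elim disjE) simp_all
    next
      case 3
      have S: "?S u = \<bar>x 0 - u\<bar> + \<bar>x 1 - u\<bar>" for u using 3 by (simp add: eval_nat_numeral)
      have "x 1 = x 0 \<or> x 1 = x 0 + 1" using x1 3 by simp
      then show ?thesis unfolding S using x0 3 by (elim disjE) simp_all
    next
      case 4
      have S: "?S u = \<bar>x 0 - u\<bar> + \<bar>x 1 - u\<bar> + \<bar>x 2 - u\<bar>" for u
        using 4 by (simp add: eval_nat_numeral)
      have "x 1 = x 0 \<or> x 1 = x 0 + 1" "x 2 = x 1 \<or> x 2 = x 1 + 1" using x1 x2 4 by simp_all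
      then show ?thesis unfolding S using x0 4 by (elim disjE) simp_all
    next
      case 5
      have S: "?S u = \<bar>x 0 - u\<bar> + \<bar>x 1 - u\<bar> + \<bar>x 2 - u\<bar> + \<bar>x 3 - u\<bar>" for u
        using 5 by (simp add: eval_nat_numeral)
      have "x 1 = x 0 \<or> x 1 = x 0 + 1" "x 2 = x 1 \<or> x 2 = x 1 + 1" "x 3 = x 2 \<or> x 3 = x 2 + 1"
        using x1 x2 x3 5 by simp_all
      then show ?thesis unfolding S using x0 5 by (elim disjE) simp_all
    next
      case 6
      have S: "?S u = \<bar>x 0 - u\<bar> + \<bar>x 1 - u\<bar> + \<bar>x 2 - u\<bar> + \<bar>x 3 - u\<bar> + \<bar>x 4 - u\<bar>" for u
        using 6 by (simp add: eval_nat_numeral)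
      have "x 1 = x 0 \<or> x 1 = x 0 + 1" "x 2 = x 1 \<or> x 2 = x 1 + 1" "x 3 = x 2 \<or> x 3 = x 2 + 1"
        "x 4 = x 3 \<or> x 4 = x 3 + 1"
        using x1 x2 x3 x4 6 by simp_all
      then show ?thesis unfolding S using x0 6 by (elim disjE) simp_all
    qed
  qed
  then have "2 * ?S (3 * k) \<le> 3 * int m \<or> 2 * ?S (3 * (k + 1)) \<le> 3 * int m"
    by (simp add: distrib_left)
  then show ?thesis by blast
qed

section \<open>Windows of consecutive integers\<close>

text \<open>
  The worst case: \<open>m\<close> consecutive integers whose median is as far as possible from \<open>3 * \<int>\<close>,
  that is, is 1 for odd \<open>m\<close> and 3/2 for even \<open>m\<close>.
\<close>

lemma two_parts_sum_abs:
  "2 * (\<Sum>j<p + q. \<bar>int j - int p\<bar>) = int p * (int p + 1) + int q * (int q - 1)"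
proof (induction q)
  case 0
  have "(\<Sum>j<p. \<bar>int j - int p\<bar>) = (\<Sum>j<p. int p - int j)" by (rule sum.cong) auto
  moreover have "2 * (\<Sum>j<p. int p - int j) = int p * (int p + 1)"
    by (subst sum.nat_diff_reindex[symmetric]) (induction p; simp add: algebra_simps)
  ultimately show ?case by simp
qed (simp add: algebra_simps)

text \<open>The window of summands slides by one: \<open>\<bar>s\<bar>\<close> leaves and
  \<open>\<bar>int m + s\<bar>\<close> enters.\<close>

lemma sum_abs_shift_one:
  "(\<Sum>j<m. \<bar>int j + (s + 1)\<bar>) = (\<Sum>j<m. \<bar>int j + s\<bar>) + \<bar>int m + s\<bar> - \<bar>s\<bar>"
  by (induction m) (auto simp: algebra_simps)

lemma sum_abs_shift_reflect:
  "(\<Sum>j<m. \<bar>int j + s\<bar>) = (\<Sum>j<m. \<bar>int j + (1 - int m - s)\<bar>)"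
  by (subst sum.nat_diff_reindex[symmetric]) (auto intro!: sum.cong)

text \<open>The second hypothesis says that the centre \<open>s + (m - 1) / 2\<close> of the window
  is nonnegative; from there a slide to the right adds at least as much as it drops.\<close>

lemma sum_abs_shift_mono:
  assumes "s \<le> t" "1 \<le> int m + 2 * s"
  shows "(\<Sum>j<m. \<bar>int j + s\<bar>) \<le> (\<Sum>j<m. \<bar>int j + t\<bar>)"
  using assms(1)
proof (induction t rule: int_ge_induct)
  case (step t)
  then have "\<bar>t\<bar> \<le> \<bar>int m + t\<bar>" using assms(2) by linarith
  with step show ?case using sum_abs_shift_one[of t m] by simp
qed simp

text \<open>The window starts where its lower median becomes 1. It arises by one slide from the
  window with \<open>p\<close> negative and \<open>q\<close> nonnegative entries, whose sum is
  \<open>two_parts_sum_abs\<close>.\<close>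

lemma sum_abs_central:
  assumes "m \<ge> 1"
  shows "4 * (\<Sum>j<m. \<bar>int j + (1 - int ((m - 1) div 2))\<bar>) = (if odd m then int m ^ 2 + 3 else int m ^ 2 + 8)"
proof -
  define p q where "p = (m - 1) div 2" and "q = m - p"
  have m: "m = p + q" by (auto simp: p_def q_def)
  have "2 * (\<Sum>j<m. \<bar>int j + - int p\<bar>) = int p * (int p + 1) + int q * (int q - 1)"
    using two_parts_sum_abs[of p q] m by simp
  then have "2 * (\<Sum>j<m. \<bar>int j + (1 - int p)\<bar>) = int p * (int p + 1) + int q * (int q - 1) + 2 * (int q - int p)"
    using sum_abs_shift_one[of "- int p" m] m by (simp add: algebra_simps)
  moreover have "q = (if odd m then p + 1 else p + 2)"
    using assms unfolding p_def q_def by presburger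
  ultimately show ?thesis unfolding p_def[symmetric] m
    by (auto simp: algebra_simps power2_eq_square split: if_splits)
qed

lemma sum_abs_shift_lower:
  assumes "m \<ge> 1"
  shows "(if odd m then int m ^ 2 + 3 else int m ^ 2 + 8)
    \<le> 4 * (\<Sum>j<m. \<bar>int j + (1 - int ((m - 1) div 2)) + 3 * k\<bar>)"
proof -
  define p where "p = (m - 1) div 2"
  define a where "a = 1 - int p"
  have "2 * p + 1 \<le> m" "m \<le> 2 * p + 2"
    using assms unfolding p_def by presburger+
  \<comment> \<open>The centre lies between 0 and 3/2. So after a shift to the left by 3 or more,
    the mirror image of the window lies at least as far right as the original window.\<close>
  then have a: "1 \<le> int m + 2 * a" "int m + 2 * a \<le> 4"
    unfolding a_def by auto
  have "(\<Sum>j<m. \<bar>int j + a\<bar>) \<le> (\<Sum>j<m. \<bar>int j + (a + 3 * k)\<bar>)"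
  proof (cases "k \<ge> 0")
    case True
    then show ?thesis using a by (intro sum_abs_shift_mono) auto
  next
    case False
    then have "(\<Sum>j<m. \<bar>int j + a\<bar>) \<le> (\<Sum>j<m. \<bar>int j + (1 - int m - (a + 3 * k))\<bar>)"
      using a by (intro sum_abs_shift_mono) auto
    then show ?thesis using sum_abs_shift_reflect[of "a + 3 * k" m] by simp
  qed
  then show ?thesis using sum_abs_central[OF assms] by (simp add: a_def p_def add.assoc)
qed

section \<open>Comparison of the bounds with \<open>rho\<close>\<close>

text \<open>Components smaller than \<open>M\<close> are no worse per vertex:
  \<open>4 * rho M\<close> is at least \<open>M + 3 / M\<close>, and since \<open>x + 3 / x\<close>
  increases in this range, it can be compared at \<open>m + 1\<close>.\<close>

lemma rho_mono_bound:
  assumes "7 \<le> m" "m \<le> M"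
  shows "4 * rho M * real m \<ge> (if odd m then real m ^ 2 + 3 else real m ^ 2 + 8)"
proof (cases "m = M")
  case True
  then show ?thesis using assms by (auto simp: rho_def field_simps power2_eq_square)
next
  case False
  then have le: "real m + 1 \<le> real M" "7 \<le> real m" using assms by auto
  have "4 * rho M \<ge> real M + 3 / real M"
    using assms by (auto simp: rho_def field_simps)
  moreover have "real M + 3 / real M \<ge> real m + 1 + 3 / (real m + 1)"
  proof -
    \<comment> \<open>The difference of the two sides, multiplied by both denominators.\<close>
    have "(real M - (real m + 1)) * (real M * (real m + 1) - 3) \<ge> 0"
    proof (rule mult_nonneg_nonneg)
      have "8 * 8 \<le> real M * (real m + 1)" by (rule mult_mono) (use le in auto)
      then show "0 \<le> real M * (real m + 1) - 3" by simp
    qed (use le in auto)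
    then show ?thesis using le by (simp add: field_simps)
  qed
  ultimately have rho: "4 * rho M \<ge> real m + 1 + 3 / (real m + 1)" by linarith
  \<comment> \<open>The factor \<open>m + 1\<close> leaves a surplus of \<open>m\<close>, which
    covers the 8 once \<open>m \<ge> 8\<close>; the remaining \<open>m = 7\<close> is odd and has to
    cover 3 only.\<close>
  have "(real m + 1 + 3 / (real m + 1)) * real m \<ge> real m ^ 2 + 8 \<or> m = 7"
  proof -
    have "3 / (real m + 1) * real m \<ge> 0" by simp
    then have "(real m + 1 + 3 / (real m + 1)) * real m \<ge> (real m + 1) * real m"
      by (simp add: distrib_right)
    moreover have "m \<noteq> 7 \<Longrightarrow> real m \<ge> 8" using le by simp
    moreover have "(real m + 1) * real m = real m ^ 2 + real m"
      by (simp add: algebra_simps power2_eq_square)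
    ultimately show ?thesis by linarith
  qed
  moreover have "(real 7 + 1 + 3 / (real 7 + 1)) * real 7 \<ge> real 7 ^ 2 + 3" by simp
  ultimately have *: "(real m + 1 + 3 / (real m + 1)) * real m \<ge> (if odd m then real m ^ 2 + 3 else real m ^ 2 + 8)"
    by auto
  have "4 * rho M * real m \<ge> (real m + 1 + 3 / (real m + 1)) * real m"
    by (rule mult_right_mono[OF rho]) simp
  with * show ?thesis by linarith
qed

lemma rho_ge:
  assumes "1 \<le> m" "m \<le> M"
  shows "rho M \<ge> 1" "m \<ge> 2 \<Longrightarrow> rho M \<ge> 3 / 2" "m \<ge> 6 \<Longrightarrow> rho M \<ge> 11 / 6"
proof -
  \<comment> \<open>The comparison at \<open>m = 7\<close> gives 52/28 = 13/7, slightly above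
    11/6.\<close>
  have seven: "rho M \<ge> 11 / 6" if "M \<ge> 7"
    using rho_mono_bound[of 7 M] that by simp
  show "rho M \<ge> 1" "m \<ge> 2 \<Longrightarrow> rho M \<ge> 3 / 2" "m \<ge> 6 \<Longrightarrow> rho M \<ge> 11 / 6"
    using assms seven by (cases "M \<ge> 7"; auto simp: rho_def)+
qed

text \<open>This is the contribution of a component with \<open>m\<close> vertices to the upper
  bound.\<close>

lemma gentle_rho:
  assumes g: "gentle m x" and m: "m \<le> M"
  shows "\<exists>k. real_of_int (\<Sum>i<m. \<bar>x i - 3 * k\<bar>) \<le> rho M * real m"
proof -
  consider "m = 0" | "m = 1" | "2 \<le> m" "m \<le> 5" | "m = 6" | "7 \<le> m" "odd m" | "7 \<le> m" "even m"
    by linarith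
  then show ?thesis
  proof cases
    case 2
    have "\<exists>k. \<bar>x 0 - 3 * k\<bar> \<le> 1" by presburger
    then obtain k where "\<bar>x 0 - 3 * k\<bar> \<le> 1" by blast
    then have "real_of_int (\<Sum>i<m. \<bar>x i - 3 * k\<bar>) \<le> 1" using 2 by simp
    then show ?thesis using rho_ge(1)[of m M] m 2 by (intro exI[of _ k]) simp
  next
    case 3
    obtain k where k: "2 * (\<Sum>i<m. \<bar>x i - 3 * k\<bar>) \<le> 3 * int m"
      using gentle_small[OF g] 3 by blast
    have "real_of_int (2 * (\<Sum>i<m. \<bar>x i - 3 * k\<bar>)) \<le> real_of_int (3 * int m)"
      using k by (simp only: of_int_le_iff)
    moreover have "3 / 2 * real m \<le> rho M * real m"
      using rho_ge(2)[of m M] m 3 by (intro mult_right_mono) auto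
    ultimately show ?thesis by (intro exI[of _ k]) simp
  next
    case 4
    obtain k where k: "(\<Sum>i<m. \<bar>x i - 3 * k\<bar>) \<le> 11"
      using gentle_even[of 3 x] g 4 by auto
    have "real_of_int (\<Sum>i<m. \<bar>x i - 3 * k\<bar>) \<le> 11"
      using k by linarith
    moreover have "11 / 6 * real m \<le> rho M * real m"
      using rho_ge(3)[of m M] m 4 by (intro mult_right_mono) auto
    ultimately show ?thesis using 4 by (intro exI[of _ k]) simp
  next
    case 5
    then obtain c where c: "m = 2 * c + 1" "c \<ge> 3" by (auto elim!: oddE)
    then obtain k where "(\<Sum>i<m. \<bar>x i - 3 * k\<bar>) \<le> int c ^ 2 + int c + 1"
      using gentle_odd[of c x] g by blast
    then have "4 * (\<Sum>i<m. \<bar>x i - 3 * k\<bar>) \<le> int m ^ 2 + 3"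
      by (simp add: c power2_eq_square algebra_simps)
    then have "real_of_int (4 * (\<Sum>i<m. \<bar>x i - 3 * k\<bar>)) \<le> real_of_int (int m ^ 2 + 3)"
      by (simp only: of_int_le_iff)
    then show ?thesis using rho_mono_bound[of m M] 5 m by (intro exI[of _ k]) simp
  next
    case 6
    then obtain c where c: "m = 2 * c" "c \<ge> 3" by (auto elim!: evenE)
    then obtain k where "(\<Sum>i<m. \<bar>x i - 3 * k\<bar>) \<le> int c ^ 2 + 2"
      using gentle_even[of c x] g by blast
    then have "4 * (\<Sum>i<m. \<bar>x i - 3 * k\<bar>) \<le> int m ^ 2 + 8"
      by (simp add: c power2_eq_square algebra_simps)
    then have "real_of_int (4 * (\<Sum>i<m. \<bar>x i - 3 * k\<bar>)) \<le> real_of_int (int m ^ 2 + 8)"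
      by (simp only: of_int_le_iff)
    then show ?thesis using rho_mono_bound[of m M] 6 m by (intro exI[of _ k]) simp
  qed simp
qed

text \<open>The extremal path need not have \<open>M\<close> vertices: for \<open>M\<close> equal to
  3 or 5 the value 3/2 is attained by two vertices, while \<open>M\<close> vertices give
  less.\<close>

lemma rho_attained:
  assumes "M \<ge> 1"
  obtains m where "1 \<le> m" "m \<le> M"
    "4 * rho M * real m = (if odd m then real m ^ 2 + 3 else real m ^ 2 + 8)"
proof -
  consider "M = 1" | "2 \<le> M" "M \<le> 5" | "M = 6" | "7 \<le> M" using assms by linarith
  then show ?thesis
  proof cases
    case 1 then show ?thesis by (intro that[of 1]) (auto simp: rho_def)
  next
    case 2 then show ?thesis by (intro that[of 2]) (auto simp: rho_def)
  next
    case 3 then show ?thesis by (intro that[of 6]) (auto simp: rho_def)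
  next
    case 4 then show ?thesis by (intro that[of M]) (auto simp: rho_def field_simps power2_eq_square)
  qed
qed

section \<open>Height functions\<close>

text \<open>A colouring is a homomorphism to the triangle; \<open>h\<close> is its lift to the
  two-way infinite path, which covers the triangle.\<close>

definition lift :: "'a pair_pre_digraph \<Rightarrow> ('a \<Rightarrow> nat) \<Rightarrow> ('a \<Rightarrow> int) \<Rightarrow> bool" where
  "lift G \<phi> h \<longleftrightarrow> (\<forall>v\<in>pverts G. int (\<phi> v) = h v mod 3 + 1) \<and>
     (\<forall>(u, v)\<in>parcs G. \<bar>h u - h v\<bar> = 1)"

lemma lift_imp_proper:
  assumes "pair_graph G" "lift G \<phi> h" "\<phi> \<in> extensional (pverts G)"
  shows "\<phi> \<in> proper_3_colorings G"
proof -
  interpret pair_graph G by fact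
  have col: "int (\<phi> v) = h v mod 3 + 1" if "v \<in> pverts G" for v
    using assms(2) that by (auto simp: lift_def)
  have "\<phi> v \<in> {1, 2, 3}" if "v \<in> pverts G" for v
    using col[OF that] pos_mod_bound[of 3 "h v"] pos_mod_sign[of 3 "h v"] by auto
  moreover have "\<phi> u \<noteq> \<phi> v" if uv: "(u, v) \<in> parcs G" for u v
  proof
    assume "\<phi> u = \<phi> v"
    then have "h u mod 3 = h v mod 3"
      using col[of u] col[of v] wellformed'[OF uv] by simp
    moreover have "h u - h v = 1 \<or> h u - h v = -1"
      using assms(2) uv by (auto simp: lift_def)
    ultimately show False by presburger
  qed
  ultimately show ?thesis
    using assms(3) by (auto simp: proper_3_colorings_def PiE_def)
qed

lemma pair_graph_wf_digraph: "pair_graph G \<Longrightarrow> wf_digraph (with_proj G)"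
  by (simp add: wf_digraph_wp_iff pair_graph_def pair_digraph_def pair_fin_digraph_def)

lemmas wf_reconfiguration_graph = pair_graph_wf_digraph[OF pair_graph_reconfiguration_graph]

lemma awalk_reconfiguration_Cons:
  "pre_digraph.awalk (with_proj (reconfiguration_graph G)) \<phi> (e # p) \<psi> \<longleftrightarrow>
    \<phi> \<in> proper_3_colorings G \<and> e \<in> parcs (reconfiguration_graph G) \<and> fst e = \<phi> \<and>
    pre_digraph.awalk (with_proj (reconfiguration_graph G)) (snd e) p \<psi>"
  by (auto simp: pre_digraph.awalk_def cas_with_proj_eq reconfiguration_graph_def)

section \<open>Recolouring walks and lifts\<close>

text \<open>The two other residues modulo 3 are those of \<open>h v + 2\<close> and
  \<open>h v - 2\<close>. A neighbour on the side away from the move would be at distance 3 from the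
  new height and share the new colour, so all neighbours lie on the side of the move.\<close>

lemma lift_after_recoloring:
  assumes "pair_graph G" and step: "(\<phi>, \<psi>) \<in> parcs (reconfiguration_graph G)" and lift: "lift G \<phi> h"
  shows "\<exists>h'. lift G \<psi> h' \<and> (\<Sum>v\<in>pverts G. \<bar>h v - h' v\<bar>) \<le> 2 \<and> (\<forall>v. even (h v - h' v))"
proof -
  interpret pair_graph G by fact
  from step obtain v where v: "v \<in> pverts G" "\<phi> v \<noteq> \<psi> v"
      and eq: "\<And>w. w \<in> pverts G \<Longrightarrow> w \<noteq> v \<Longrightarrow> \<psi> w = \<phi> w"
      and psi: "\<psi> \<in> proper_3_colorings G"
    unfolding reconfiguration_graph_def by simp (metis (no_types, lifting))
  have phi: "int (\<phi> w) = h w mod 3 + 1" if "w \<in> pverts G" for w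
    using lift that by (auto simp: lift_def)
  have "\<psi> v \<in> {1, 2, 3}" using psi v by (auto simp: proper_3_colorings_def)
  then have "int (\<psi> v) = (h v + 2) mod 3 + 1 \<or> int (\<psi> v) = (h v - 2) mod 3 + 1"
  proof -
    have "int (\<psi> v) = 1 \<or> int (\<psi> v) = 2 \<or> int (\<psi> v) = 3" using \<open>\<psi> v \<in> {1, 2, 3}\<close> by auto
    moreover have "int (\<psi> v) \<noteq> h v mod 3 + 1" using phi[OF v(1)] v(2) by auto
    ultimately show ?thesis by presburger
  qed
  then obtain e where e: "e = 2 \<or> e = -2" "int (\<psi> v) = (h v + e) mod 3 + 1"
    by fastforce
  define h' where "h' = h(v := h v + e)"
  have nbr: "\<bar>h v + e - h w\<bar> = 1" if vw: "(v, w) \<in> parcs G" for w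
  proof -
    have w: "w \<in> pverts G" "w \<noteq> v" using wellformed'[OF vw] no_loops'[OF vw] by auto
    have "\<psi> v \<noteq> \<psi> w" using psi vw by (auto simp: proper_3_colorings_def)
    then have "(h v + e) mod 3 \<noteq> h w mod 3" using e(2) phi[OF w(1)] eq[OF w] by auto
    moreover have "h v - h w = 1 \<or> h v - h w = -1" using lift vw by (auto simp: lift_def)
    ultimately show ?thesis using e(1) by presburger
  qed
  have "lift G \<psi> h'"
    unfolding lift_def
  proof (intro conjI ballI, goal_cases)
    case (1 w)
    then show ?case using e(2) phi[of w] eq[of w] by (cases "w = v") (auto simp: h'_def)
  next
    case (2 a)
    obtain u w where a: "a = (u, w)" by (cases a)
    then have uw: "(u, w) \<in> parcs G" "(w, u) \<in> parcs G" "u \<noteq> w"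
      using 2 arcs_symmetric no_loops' by auto
    have "\<bar>h' u - h' w\<bar> = 1"
      using uw nbr[of w] nbr[of u] lift unfolding h'_def lift_def
      by (auto simp: abs_minus_commute split: if_splits)
    then show ?case by (simp add: a)
  qed
  moreover have "(\<Sum>w\<in>pverts G. \<bar>h w - h' w\<bar>) = (\<Sum>w\<in>{v}. \<bar>h w - h' w\<bar>)"
    by (rule sum.mono_neutral_right) (use v in \<open>auto simp: h'_def pair_finite_verts\<close>)
  then have "(\<Sum>w\<in>pverts G. \<bar>h w - h' w\<bar>) \<le> 2" using e(1) by (auto simp: h'_def)
  moreover have "\<forall>w. even (h w - h' w)" using e(1) by (auto simp: h'_def)
  ultimately show ?thesis by blast
qed

text \<open>This yields lower bounds on distances: a short walk to \<open>\<psi>\<close> would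
  produce a lift of \<open>\<psi>\<close> close to \<open>h\<close>.\<close>

lemma lift_along_awalk:
  assumes "pair_graph G" and "lift G \<phi> h"
    and "pre_digraph.awalk (with_proj (reconfiguration_graph G)) \<phi> p \<psi>"
  shows "\<exists>h'. lift G \<psi> h' \<and> (\<Sum>v\<in>pverts G. \<bar>h v - h' v\<bar>) \<le> 2 * int (length p) \<and> (\<forall>v. even (h v - h' v))"
  using assms(2,3)
proof (induction p arbitrary: \<phi> h)
  case Nil
  then have "\<phi> = \<psi>" by (simp add: pre_digraph.awalk_def cas_with_proj_eq)
  then show ?case using Nil by (intro exI[of _ h]) simp
next
  case (Cons e p)
  let ?\<chi> = "snd e"
  from Cons.prems have e: "(\<phi>, ?\<chi>) \<in> parcs (reconfiguration_graph G)"
    and p: "pre_digraph.awalk (with_proj (reconfiguration_graph G)) ?\<chi> p \<psi>"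
    unfolding awalk_reconfiguration_Cons by (cases e; auto)+
  obtain h1 where h1: "lift G ?\<chi> h1" "(\<Sum>v\<in>pverts G. \<bar>h v - h1 v\<bar>) \<le> 2" "\<forall>v. even (h v - h1 v)"
    using lift_after_recoloring[OF assms(1) e Cons.prems(1)] by blast
  obtain h2 where h2: "lift G \<psi> h2" "(\<Sum>v\<in>pverts G. \<bar>h1 v - h2 v\<bar>) \<le> 2 * int (length p)"
      "\<forall>v. even (h1 v - h2 v)"
    using Cons.IH[OF h1(1) p] by blast
  have "(\<Sum>v\<in>pverts G. \<bar>h v - h2 v\<bar>) \<le> (\<Sum>v\<in>pverts G. \<bar>h v - h1 v\<bar> + \<bar>h1 v - h2 v\<bar>)"
    by (rule sum_mono) linarith
  also have "\<dots> \<le> 2 * int (length (e # p))"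
    using h1(2) h2(2) by (simp add: sum.distrib)
  finally have "(\<Sum>v\<in>pverts G. \<bar>h v - h2 v\<bar>) \<le> 2 * int (length (e # p))" .
  moreover have "even (h v - h2 v)" for v using h1(3) h2(3) by (metis even_diff even_add)
  ultimately show ?case using h2(1) by blast
qed

text \<open>All neighbours lie on one side of \<open>v\<close>, so \<open>v\<close> can jump over
  them to \<open>h v + 2 * e\<close> with all height differences still 1; the colour changes because
  2 is not divisible by 3.\<close>

lemma recolor_extremum:
  assumes "pair_graph G" and phi: "\<phi> \<in> proper_3_colorings G" and lift: "lift G \<phi> h"
    and v: "v \<in> pverts G" and e: "e = 1 \<or> e = -1"
    and nbr: "\<And>w. (v, w) \<in> parcs G \<Longrightarrow> h w = h v + e"
  shows "\<exists>\<psi> \<in> proper_3_colorings G. lift G \<psi> (h(v := h v + 2 * e)) \<and>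
    (\<phi>, \<psi>) \<in> parcs (reconfiguration_graph G)"
proof -
  interpret pair_graph G by fact
  define h' where "h' = h(v := h v + 2 * e)"
  define \<psi> where "\<psi> = \<phi>(v := nat (h' v mod 3 + 1))"
  have phi': "int (\<phi> w) = h w mod 3 + 1" if "w \<in> pverts G" for w
    using lift that by (auto simp: lift_def)
  have lift': "lift G \<psi> h'"
    unfolding lift_def
  proof (intro conjI ballI, goal_cases)
    case (1 w)
    then show ?case using phi'[of w] by (auto simp: h'_def \<psi>_def)
  next
    case (2 a)
    obtain u w where a: "a = (u, w)" by (cases a)
    then have uw: "(u, w) \<in> parcs G" "(w, u) \<in> parcs G" "u \<noteq> w"
      using 2 arcs_symmetric no_loops' by auto
    have "\<bar>h' u - h' w\<bar> = 1"
      using uw nbr[of w] nbr[of u] lift e unfolding h'_def lift_def by auto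
    then show ?case by (simp add: a)
  qed
  have psi: "\<psi> \<in> proper_3_colorings G"
    by (rule lift_imp_proper[OF assms(1) lift'])
      (use phi v in \<open>auto simp: \<psi>_def proper_3_colorings_def PiE_def extensional_def\<close>)
  have "int (\<psi> v) \<noteq> int (\<phi> v)"
    using phi'[OF v] e by (auto simp: \<psi>_def h'_def) presburger+
  then have "\<exists>!w. w \<in> pverts G \<and> \<phi> w \<noteq> \<psi> w"
    using v by (intro ex1I[of _ v]) (auto simp: \<psi>_def split: if_splits)
  then have "(\<phi>, \<psi>) \<in> parcs (reconfiguration_graph G)"
    using phi psi by (simp add: reconfiguration_graph_def)
  then show ?thesis using psi lift' unfolding h'_def by blast
qed

text \<open>Among the vertices with \<open>h v > g v\<close> take one with \<open>h v\<close>
  largest. A higher neighbour \<open>w\<close> would have \<open>h w \<le> g w\<close>, whereas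
  parity gives \<open>g v \<le> h v - 2\<close> and hence \<open>g w < h w\<close>. If
  \<open>h\<close> is nowhere above \<open>g\<close>, the lowest vertex with
  \<open>h v < g v\<close> works symmetrically.\<close>

lemma exists_extremum_towards:
  assumes "pair_graph G" and h: "lift G \<phi> h" and g: "lift G \<psi> g"
    and par: "\<And>v. v \<in> pverts G \<Longrightarrow> even (h v - g v)"
    and ne: "\<exists>v\<in>pverts G. h v \<noteq> g v"
  shows "\<exists>v\<in>pverts G. \<exists>e. (e = 1 \<or> e = -1) \<and> \<bar>h v + 2 * e - g v\<bar> = \<bar>h v - g v\<bar> - 2 \<and>
    (\<forall>w. (v, w) \<in> parcs G \<longrightarrow> h w = h v + e)"
proof -
  interpret pair_graph G by fact
  have adj: "\<bar>h v - h w\<bar> = 1" "\<bar>g v - g w\<bar> = 1" if "(v, w) \<in> parcs G" for v w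
    using h g that by (auto simp: lift_def)
  have far: "\<bar>h v - g v\<bar> \<ge> 2" if "v \<in> pverts G" "h v \<noteq> g v" for v
    using par[OF that(1)] that(2) by presburger
  show ?thesis
  proof (cases "\<exists>v\<in>pverts G. h v > g v")
    case True
    define A where "A = {v \<in> pverts G. h v > g v}"
    have "finite A" "A \<noteq> {}" using True pair_finite_verts by (auto simp: A_def)
    then obtain v where v: "v \<in> A" and mx: "\<And>w. w \<in> A \<Longrightarrow> h w \<le> h v"
      using ex_is_arg_min_if_finite[of A "\<lambda>w. - h w"] by (auto simp: is_arg_min_linorder)
    have "h w = h v - 1" if vw: "(v, w) \<in> parcs G" for w
    proof (rule ccontr)
      assume "h w \<noteq> h v - 1"
      then have hw: "h w = h v + 1" using adj(1)[OF vw] by linarith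
      then have "w \<notin> A" using mx by force
      then have "h w \<le> g w" using wellformed'[OF vw] by (auto simp: A_def)
      moreover have "h v - g v \<ge> 2" using far[of v] v by (auto simp: A_def)
      ultimately show False using adj(2)[OF vw] hw by linarith
    qed
    then show ?thesis using v far[of v] by (intro bexI[of _ v] exI[of _ "-1"]) (auto simp: A_def)
  next
    case False
    define A where "A = {v \<in> pverts G. h v < g v}"
    have "\<exists>v\<in>pverts G. h v < g v" using False ne by (metis linorder_less_linear)
    then have "finite A" "A \<noteq> {}" using pair_finite_verts by (auto simp: A_def)
    then obtain v where v: "v \<in> A" and mn: "\<And>w. w \<in> A \<Longrightarrow> h v \<le> h w"
      using ex_is_arg_min_if_finite[of A h] by (auto simp: is_arg_min_linorder)
    have "h w = h v + 1" if vw: "(v, w) \<in> parcs G" for w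
    proof (rule ccontr)
      assume "h w \<noteq> h v + 1"
      then have hw: "h w = h v - 1" using adj(1)[OF vw] by linarith
      then have "w \<notin> A" using mn by force
      then have "h w \<ge> g w" using wellformed'[OF vw] by (auto simp: A_def)
      moreover have "g v - h v \<ge> 2" using far[of v] v by (auto simp: A_def)
      ultimately show False using adj(2)[OF vw] hw by linarith
    qed
    then show ?thesis using v far[of v] by (intro bexI[of _ v] exI[of _ 1]) (auto simp: A_def)
  qed
qed

text \<open>Each move given by \<open>exists_extremum_towards\<close> lowers the total height
  difference by exactly 2; once the lifts agree, so do the colourings.\<close>

lemma awalk_between_lifts:
  assumes "pair_graph G" and "\<phi> \<in> proper_3_colorings G" "\<psi> \<in> proper_3_colorings G"
    and "lift G \<phi> h" "lift G \<psi> g" and "\<And>v. v \<in> pverts G \<Longrightarrow> even (h v - g v)"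
  shows "\<exists>p. pre_digraph.awalk (with_proj (reconfiguration_graph G)) \<phi> p \<psi> \<and>
    2 * int (length p) = (\<Sum>v\<in>pverts G. \<bar>h v - g v\<bar>)"
  using assms(2-6)
proof (induction "nat (\<Sum>v\<in>pverts G. \<bar>h v - g v\<bar>)" arbitrary: \<phi> h rule: less_induct)
  case less
  interpret pair_graph G by fact
  note fin = pair_finite_verts
  show ?case
  proof (cases "\<exists>v\<in>pverts G. h v \<noteq> g v")
    case False
    have "\<phi> = \<psi>"
    proof (rule PiE_ext)
      show "\<phi> \<in> pverts G \<rightarrow>\<^sub>E {1, 2, 3}" "\<psi> \<in> pverts G \<rightarrow>\<^sub>E {1, 2, 3}"
        using less.prems(1,2) by (auto simp: proper_3_colorings_def)
      fix v assume "v \<in> pverts G"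
      then have "int (\<phi> v) = int (\<psi> v)" using False less.prems(3,4) by (auto simp: lift_def)
      then show "\<phi> v = \<psi> v" by simp
    qed
    then have "pre_digraph.awalk (with_proj (reconfiguration_graph G)) \<phi> [] \<psi>"
      using less.prems(1) by (simp add: pre_digraph.awalk_def cas_with_proj_eq reconfiguration_graph_def)
    then show ?thesis using False by (intro exI[of _ "[]"]) simp
  next
    case True
    obtain v e where v: "v \<in> pverts G" and e: "e = 1 \<or> e = -1"
      and dist: "\<bar>h v + 2 * e - g v\<bar> = \<bar>h v - g v\<bar> - 2"
      and nbr: "\<And>w. (v, w) \<in> parcs G \<Longrightarrow> h w = h v + e"
      using exists_extremum_towards[OF assms(1) less.prems(3,4,5) True] by metis
    define h' where "h' = h(v := h v + 2 * e)"
    obtain \<chi> where chi: "\<chi> \<in> proper_3_colorings G" "lift G \<chi> h'"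
        "(\<phi>, \<chi>) \<in> parcs (reconfiguration_graph G)"
      using recolor_extremum[OF assms(1) less.prems(1,3) v e nbr] unfolding h'_def by blast
    have "(\<Sum>w\<in>pverts G. \<bar>h' w - g w\<bar>) = \<bar>h' v - g v\<bar> + (\<Sum>w\<in>pverts G - {v}. \<bar>h' w - g w\<bar>)"
      using sum.remove[OF fin v] by blast
    also have "(\<Sum>w\<in>pverts G - {v}. \<bar>h' w - g w\<bar>) = (\<Sum>w\<in>pverts G - {v}. \<bar>h w - g w\<bar>)"
      by (rule sum.cong) (auto simp: h'_def)
    also have "\<bar>h' v - g v\<bar> = \<bar>h v - g v\<bar> - 2" using dist by (simp add: h'_def)
    also have "\<bar>h v - g v\<bar> - 2 + (\<Sum>w\<in>pverts G - {v}. \<bar>h w - g w\<bar>) = (\<Sum>w\<in>pverts G. \<bar>h w - g w\<bar>) - 2"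
      using sum.remove[OF fin v, of "\<lambda>w. \<bar>h w - g w\<bar>"] by simp
    finally have sum: "(\<Sum>w\<in>pverts G. \<bar>h' w - g w\<bar>) = (\<Sum>w\<in>pverts G. \<bar>h w - g w\<bar>) - 2" .
    have "(\<Sum>w\<in>pverts G. \<bar>h' w - g w\<bar>) \<ge> 0" by (rule sum_nonneg) simp
    then have lt: "nat (\<Sum>w\<in>pverts G. \<bar>h' w - g w\<bar>) < nat (\<Sum>w\<in>pverts G. \<bar>h w - g w\<bar>)"
      using sum by linarith
    have par: "even (h' w - g w)" if "w \<in> pverts G" for w
      using less.prems(5)[OF that] by (auto simp: h'_def)
    obtain p where p: "pre_digraph.awalk (with_proj (reconfiguration_graph G)) \<chi> p \<psi>"
        "2 * int (length p) = (\<Sum>v\<in>pverts G. \<bar>h' v - g v\<bar>)"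
      using less.hyps[OF lt chi(1) less.prems(2) chi(2) less.prems(4) par] by blast
    have "pre_digraph.awalk (with_proj (reconfiguration_graph G)) \<phi> ((\<phi>, \<chi>) # p) \<psi>"
      using p(1) chi(3) less.prems(1) by (simp add: awalk_reconfiguration_Cons)
    moreover have "2 * int (length ((\<phi>, \<chi>) # p)) = (\<Sum>v\<in>pverts G. \<bar>h v - g v\<bar>)"
      using p(2) sum by simp
    ultimately show ?thesis by blast
  qed
qed

section \<open>Forests\<close>

text \<open>Connectedness expressed by cuts, the form needed both for excluding gaps between values
  and for growing a vertex set edge by edge.\<close>

definition linked :: "'a rel \<Rightarrow> 'a set \<Rightarrow> bool" where
  "linked E C \<longleftrightarrow> (\<forall>S. S \<subseteq> C \<and> S \<noteq> {} \<and> S \<noteq> C \<longrightarrow> (\<exists>a\<in>S. \<exists>b\<in>C - S. (a, b) \<in> E))"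

lemma linkedD:
  assumes "linked E C" "S \<subseteq> C" "S \<noteq> {}" "S \<noteq> C"
  obtains a b where "a \<in> S" "b \<in> C - S" "(a, b) \<in> E"
  using assms unfolding linked_def by metis

text \<open>Sort the values. A jump by 2 or more would separate the vertices below it from those
  above it, but some arc crosses this cut and \<open>d\<close> changes by at most 1 along
  it.\<close>

lemma linked_values_gentle:
  assumes C: "finite C" "linked E C" and d: "\<And>u v. (u, v) \<in> E \<Longrightarrow> \<bar>d u - d v\<bar> \<le> 1"
  shows "\<exists>x. gentle (card C) x \<and> (\<forall>t. (\<Sum>v\<in>C. \<bar>d v - t\<bar>) = (\<Sum>i<card C. \<bar>x i - t\<bar>))"
proof -
  obtain l where l: "set l = C" "distinct l" using finite_distinct_list[OF C(1)] by blast
  define xs where "xs = sort (map d l)"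
  have len: "length xs = card C" using distinct_card[OF l(2)] l(1) by (simp add: xs_def)
  have sorted: "sorted xs" by (simp add: xs_def)
  have set: "set xs = d ` C" using l by (simp add: xs_def)
  have "xs ! i \<le> xs ! Suc i \<and> xs ! Suc i \<le> xs ! i + 1" if i: "Suc i < card C" for i
  proof
    show "xs ! i \<le> xs ! Suc i" using sorted i len by (intro sorted_nth_mono) auto
    show "xs ! Suc i \<le> xs ! i + 1"
    proof (rule ccontr)
      assume gap: "\<not> xs ! Suc i \<le> xs ! i + 1"
      define S where "S = {v \<in> C. d v \<le> xs ! i}"
      have "xs ! i \<in> d ` C" "xs ! Suc i \<in> d ` C" using i len set nth_mem by (metis Suc_lessD)+
      then obtain u w where "u \<in> C" "d u = xs ! i" "w \<in> C" "d w = xs ! Suc i" by (metis imageE)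
      then have "u \<in> S" "w \<in> C" "w \<notin> S" using gap by (auto simp: S_def)
      then have "S \<subseteq> C" "S \<noteq> {}" "S \<noteq> C" by (auto simp: S_def)
      then obtain a b where ab: "a \<in> S" "b \<in> C - S" "(a, b) \<in> E"
        by (rule linkedD[OF C(2)])
      then have db: "d b \<in> set xs" "d b > xs ! i" "d b \<le> xs ! i + 1"
        using d[OF ab(3)] set by (auto simp: S_def)
      then obtain j where j: "j < length xs" "xs ! j = d b" by (auto simp: in_set_conv_nth)
      show False
      proof (cases "j \<le> i")
        case True
        then have "xs ! j \<le> xs ! i" using sorted i len by (intro sorted_nth_mono) auto
        then show False using j db by simp
      next
        case False
        then have "xs ! Suc i \<le> xs ! j" using sorted j by (intro sorted_nth_mono) auto
        then show False using j db gap by simp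
      qed
    qed
  qed
  then have "gentle (card C) ((!) xs)" by (simp add: gentle_def)
  moreover have "(\<Sum>v\<in>C. \<bar>d v - t\<bar>) = (\<Sum>i<card C. \<bar>xs ! i - t\<bar>)" for t
  proof -
    have "(\<Sum>v\<in>C. \<bar>d v - t\<bar>) = sum_list (map (\<lambda>y. \<bar>y - t\<bar>) (map d l))"
      using l by (simp add: sum_list_distinct_conv_sum_set o_def)
    also have "\<dots> = sum_list (map (\<lambda>y. \<bar>y - t\<bar>) xs)"
      unfolding xs_def sum_mset_sum_list[symmetric] by (simp only: mset_map mset_sort)
    also have "\<dots> = (\<Sum>i<card C. \<bar>xs ! i - t\<bar>)"
      by (simp add: sum_list_sum_nth len atLeast0LessThan)
    finally show ?thesis .
  qed
  ultimately show ?thesis by blast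
qed

section \<open>Edge counts and the maximum average degree\<close>

definition edges_within :: "'a pair_pre_digraph \<Rightarrow> 'a set \<Rightarrow> 'a set set" where
  "edges_within G S = (\<lambda>(u, v). {u, v}) ` (parcs G \<inter> S \<times> S)"

text \<open>Needed for reasoning about \<open>Max\<close> in \<open>mad\<close>: each ratio depends
  only on a subset of the vertices and a subset of the arcs.\<close>

lemma finite_average_degrees:
  assumes "pair_graph G"
  shows "finite {2 * real (card (edges H)) / real (card (pverts H)) | H.
     pair_graph H \<and> subgraph (with_proj H) (with_proj G) \<and> pverts H \<noteq> {}}" (is "finite ?Q")
proof -
  interpret pair_graph G by fact
  let ?f = "\<lambda>(V, E). 2 * real (card ((\<lambda>(u, v). {u, v}) ` E)) / real (card V)"
  have "?Q \<subseteq> ?f ` (Pow (pverts G) \<times> Pow (parcs G))"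
  proof
    fix q assume "q \<in> ?Q"
    then obtain K where K: "q = 2 * real (card (edges K)) / real (card (pverts K))"
        "subgraph (with_proj K) (with_proj G)"
      by auto
    then show "q \<in> ?f ` (Pow (pverts G) \<times> Pow (parcs G))"
      by (intro image_eqI[of _ _ "(pverts K, parcs K)"]) (auto simp: edges_def subgraph_def)
  qed
  then show ?thesis
    by (rule finite_subset) (auto simp: pair_finite_verts pair_finite_arcs)
qed

text \<open>Induced subgraphs suffice, as they have the most edges on a given vertex set.\<close>

lemma mad_leI:
  assumes "pair_graph G" "pverts G \<noteq> {}"
    and "\<And>S. S \<subseteq> pverts G \<Longrightarrow> S \<noteq> {} \<Longrightarrow> 2 * real (card (edges_within G S)) \<le> b * real (card S)"
  shows "mad G \<le> b"
  unfolding mad_def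
proof (rule Max.boundedI[OF finite_average_degrees[OF assms(1)]])
  interpret pair_graph G by fact
  have "subgraph (with_proj G) (with_proj G)"
    by (simp add: subgraph_def compatible_def pair_graph_wf_digraph assms(1))
  then show "{2 * real (card (edges H)) / real (card (pverts H)) | H.
     pair_graph H \<and> subgraph (with_proj H) (with_proj G) \<and> pverts H \<noteq> {}} \<noteq> {}"
    using assms(1,2) by blast
  fix q assume "q \<in> {2 * real (card (edges H)) / real (card (pverts H)) | H.
     pair_graph H \<and> subgraph (with_proj H) (with_proj G) \<and> pverts H \<noteq> {}}"
  then obtain H where q: "q = 2 * real (card (edges H)) / real (card (pverts H))"
    and H: "pair_graph H" "subgraph (with_proj H) (with_proj G)" "pverts H \<noteq> {}"
    by auto
  interpret H: pair_graph H by fact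
  have sub: "pverts H \<subseteq> pverts G" "parcs H \<subseteq> parcs G" using H(2) by (auto simp: subgraph_def)
  have "edges H \<subseteq> edges_within G (pverts H)"
    using sub H.wellformed' by (auto simp: edges_def edges_within_def)
  then have "card (edges H) \<le> card (edges_within G (pverts H))"
    by (rule card_mono[rotated]) (simp add: edges_within_def pair_finite_arcs)
  then have "2 * real (card (edges H)) \<le> b * real (card (pverts H))"
    using assms(3)[OF sub(1) H(3)] by linarith
  then show "q \<le> b"
    using H(3) H.pair_finite_verts by (simp add: q divide_le_eq card_gt_0_iff)
qed

lemma edges_within_le_mad:
  assumes "pair_graph G" "S \<subseteq> pverts G" "S \<noteq> {}"
  shows "2 * real (card (edges_within G S)) \<le> mad G * real (card S)"
proof -
  interpret pair_graph G by fact
  define Q where "Q = {2 * real (card (edges H)) / real (card (pverts H)) | H.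
     pair_graph H \<and> subgraph (with_proj H) (with_proj G) \<and> pverts H \<noteq> {}}"
  define H where "H = \<lparr>pverts = S, parcs = parcs G \<inter> S \<times> S\<rparr>"
  have finS: "finite S" using assms(2) pair_finite_verts finite_subset by blast
  have H: "pair_graph H"
    using finS pair_finite_arcs no_loops' arcs_symmetric
    by unfold_locales (auto simp: H_def symmetric_def sym_def)
  moreover have "subgraph (with_proj H) (with_proj G)"
    using assms(1,2) H by (auto simp: subgraph_def compatible_def H_def
        intro!: pair_graph_wf_digraph)
  ultimately have in_Q: "2 * real (card (edges_within G S)) / real (card S) \<in> Q"
    unfolding Q_def using assms(3)
    by (intro CollectI exI[of _ H]) (auto simp: H_def edges_def edges_within_def)
  have "finite Q" unfolding Q_def by (rule finite_average_degrees[OF assms(1)])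
  then have "2 * real (card (edges_within G S)) / real (card S) \<le> mad G"
    using in_Q by (simp add: mad_def Q_def[symmetric])
  then show ?thesis using finS assms(3) by (simp add: divide_le_eq card_gt_0_iff)
qed

text \<open>Grow a vertex set from a single vertex: while it is not all of \<open>C\<close>, an arc
  leads out of it, and adding the end of that arc adds a new edge.\<close>

lemma linked_card_le:
  assumes "finite (parcs G)" "finite C" "linked (parcs G) C" "r \<in> C"
  shows "card C \<le> card (edges_within G C) + 1"
proof -
  have fin: "finite (edges_within G S)" for S using assms(1) by (simp add: edges_within_def)
  have "\<exists>S \<subseteq> C. card S = n \<and> S \<noteq> {} \<and> n \<le> card (edges_within G S) + 1" if "1 \<le> n" "n \<le> card C" for n
    using that
  proof (induction n rule: dec_induct)
    case base
    then show ?case using assms(4) by (intro exI[of _ "{r}"]) auto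
  next
    case (step n)
    then obtain S where S: "S \<subseteq> C" "card S = n" "S \<noteq> {}" "n \<le> card (edges_within G S) + 1" by auto
    then have "S \<noteq> C" using step by auto
    then obtain a b where ab: "a \<in> S" "b \<in> C" "b \<notin> S" "(a, b) \<in> parcs G"
      using assms(3) S unfolding linked_def by blast
    have "{a, b} \<in> edges_within G (insert b S)" "{a, b} \<notin> edges_within G S"
      using ab by (auto simp: edges_within_def doubleton_eq_iff)
    moreover have "edges_within G S \<subseteq> edges_within G (insert b S)"
      by (auto simp: edges_within_def)
    ultimately have "card (edges_within G S) < card (edges_within G (insert b S))"
      using fin by (intro psubset_card_mono) auto
    moreover have "finite S" using S(1) assms(2) finite_subset by blast
    then have "card (insert b S) = Suc n" using ab S(2) by simp
    ultimately show ?case using S ab(2) by (intro exI[of _ "insert b S"]) auto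
  qed
  moreover have "1 \<le> card C" using assms(2,4) by (auto simp: Suc_le_eq card_gt_0_iff)
  ultimately obtain S where "S \<subseteq> C" "card S = card C" "card C \<le> card (edges_within G S) + 1"
    by blast
  moreover then have "S = C" using card_subset_eq[OF assms(2)] by blast
  ultimately show ?thesis by simp
qed

lemma card_parcs_within_le:
  assumes "finite (parcs G)"
  shows "card (parcs G \<inter> S \<times> S) \<le> 2 * card (edges_within G S)"
proof -
  let ?A = "parcs G \<inter> S \<times> S" and ?f = "\<lambda>(u, v). {u, v}"
  have "card ?A = card (\<Union>e\<in>edges_within G S. {a \<in> ?A. ?f a = e})"
    by (rule arg_cong[of _ _ card]) (auto simp: edges_within_def)
  also have "\<dots> \<le> (\<Sum>e\<in>edges_within G S. card {a \<in> ?A. ?f a = e})"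
    by (rule card_UN_le) (use assms in \<open>simp add: edges_within_def\<close>)
  also have "\<dots> \<le> (\<Sum>e\<in>edges_within G S. 2)"
  proof (rule sum_mono)
    fix e assume "e \<in> edges_within G S"
    then obtain u v where e: "e = {u, v}" by (auto simp: edges_within_def)
    have "{a \<in> ?A. ?f a = e} \<subseteq> {(u, v), (v, u)}"
      unfolding e by (clarsimp simp: doubleton_eq_iff)
    then have "card {a \<in> ?A. ?f a = e} \<le> card {(u, v), (v, u)}" by (rule card_mono[rotated]) simp
    also have "\<dots> \<le> 2" using card_length[of "[(u, v), (v, u)]"] by simp
    finally show "card {a \<in> ?A. ?f a = e} \<le> 2" .
  qed
  finally show ?thesis by simp
qed

text \<open>If every vertex of \<open>S\<close> had two neighbours in \<open>S\<close>, counting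
  arcs would give at least \<open>card S\<close> edges within \<open>S\<close>, hence average degree
  at least 2.\<close>

lemma exists_leaf:
  assumes "pair_graph G" "mad G < 2" "S \<subseteq> pverts G" "S \<noteq> {}"
  shows "\<exists>v\<in>S. \<forall>u\<in>S. \<forall>w\<in>S. (v, u) \<in> parcs G \<longrightarrow> (v, w) \<in> parcs G \<longrightarrow> u = w"
proof (rule ccontr)
  assume no_leaf: "\<not> ?thesis"
  interpret pair_graph G by fact
  have fin: "finite S" using assms(3) pair_finite_verts finite_subset by blast
  have two: "2 \<le> card {u \<in> S. (v, u) \<in> parcs G}" if v: "v \<in> S" for v
  proof -
    obtain u w where "u \<in> S" "w \<in> S" "(v, u) \<in> parcs G" "(v, w) \<in> parcs G" "u \<noteq> w"
      using no_leaf v by blast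
    then have "{u, w} \<subseteq> {u \<in> S. (v, u) \<in> parcs G}" "card {u, w} = 2" by auto
    then show ?thesis using card_mono[of "{u \<in> S. (v, u) \<in> parcs G}" "{u, w}"] fin by simp
  qed
  have "2 * card S = (\<Sum>v\<in>S. 2)" by simp
  also have "\<dots> \<le> (\<Sum>v\<in>S. card {u \<in> S. (v, u) \<in> parcs G})" by (rule sum_mono) (use two in blast)
  also have "\<dots> = card (SIGMA v:S. {u \<in> S. (v, u) \<in> parcs G})" using fin by simp
  also have "(SIGMA v:S. {u \<in> S. (v, u) \<in> parcs G}) = parcs G \<inter> S \<times> S" by auto
  also have "card \<dots> \<le> 2 * card (edges_within G S)"
    by (rule card_parcs_within_le[OF pair_finite_arcs])
  finally have "2 * real (card S) \<le> 2 * real (card (edges_within G S))" by simp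
  also have "\<dots> \<le> mad G * real (card S)" by (rule edges_within_le_mad[OF assms(1,3,4)])
  also have "\<dots> < 2 * real (card S)"
    using assms(2,4) fin by (intro mult_strict_right_mono) (auto simp: card_gt_0_iff)
  finally show False by simp
qed

section \<open>Lifting colourings of forests\<close>

lemma extend_lift:
  fixes c :: nat and x :: int
  assumes "c \<in> {1, 2, 3}" "int d = x mod 3 + 1" "c \<noteq> d"
  shows "\<exists>y. int c = y mod 3 + 1 \<and> \<bar>y - x\<bar> = 1"
proof -
  have "int c = 1 \<or> int c = 2 \<or> int c = 3" "int c \<noteq> x mod 3 + 1" using assms by auto
  then have "int c = (x + 1) mod 3 + 1 \<or> int c = (x - 1) mod 3 + 1" by presburger
  then show ?thesis
    by (elim disjE) (rule exI[of _ "x + 1"], simp, rule exI[of _ "x - 1"], simp)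
qed

text \<open>Both lifts are built by adding leaves. Along the edge to the leaf each height changes by
  1 in absolute value, so the parity of \<open>h - g\<close> is carried over.\<close>

lemma exists_lifts:
  assumes "pair_graph G" "mad G < 2"
    and phi: "\<phi> \<in> proper_3_colorings G" and psi: "\<psi> \<in> proper_3_colorings G"
  shows "\<exists>h g. lift G \<phi> h \<and> lift G \<psi> g \<and> (\<forall>v\<in>pverts G. even (h v - g v))"
proof -
  interpret pair_graph G by fact
  have col: "\<phi> v \<in> {1, 2, 3}" "\<psi> v \<in> {1, 2, 3}" if "v \<in> pverts G" for v
    using phi psi that by (auto simp: proper_3_colorings_def)
  have ne: "\<phi> u \<noteq> \<phi> v" "\<psi> u \<noteq> \<psi> v" if "(u, v) \<in> parcs G" for u v
    using phi psi that by (auto simp: proper_3_colorings_def)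
  have "\<exists>h g. (\<forall>v\<in>S. int (\<phi> v) = h v mod 3 + 1 \<and> int (\<psi> v) = g v mod 3 + 1 \<and> even (h v - g v)) \<and>
    (\<forall>u\<in>S. \<forall>v\<in>S. (u, v) \<in> parcs G \<longrightarrow> \<bar>h u - h v\<bar> = (1::int) \<and> \<bar>g u - g v\<bar> = (1::int))"
    if "S \<subseteq> pverts G" for S
    using finite_subset[OF that pair_finite_verts] that
  proof (induction S rule: finite_psubset_induct)
    case (psubset S)
    show ?case
    proof (cases "S = {}")
      case False
      obtain v where v: "v \<in> S"
        and leaf: "\<And>u w. u \<in> S \<Longrightarrow> w \<in> S \<Longrightarrow> (v, u) \<in> parcs G \<Longrightarrow> (v, w) \<in> parcs G \<Longrightarrow> u = w"
        using exists_leaf[OF assms(1,2) psubset.prems False] by blast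
      let ?T = "S - {v}"
      have "?T \<subset> S" "?T \<subseteq> pverts G" using v psubset.prems by auto
      from psubset.IH[OF this] obtain h g where
        hg: "\<And>w. w \<in> ?T \<Longrightarrow> int (\<phi> w) = h w mod 3 + 1 \<and> int (\<psi> w) = g w mod 3 + 1 \<and> even (h w - g w)"
        and adj: "\<And>u w. u \<in> ?T \<Longrightarrow> w \<in> ?T \<Longrightarrow> (u, w) \<in> parcs G \<Longrightarrow> \<bar>h u - h w\<bar> = (1::int) \<and> \<bar>g u - g w\<bar> = (1::int)"
        by blast
      have vG: "v \<in> pverts G" using v psubset.prems by auto
      obtain y z where yz: "int (\<phi> v) = y mod 3 + 1" "int (\<psi> v) = z mod 3 + 1" "even (y - z)"
        "\<And>u. u \<in> S \<Longrightarrow> (v, u) \<in> parcs G \<Longrightarrow> \<bar>y - h u\<bar> = 1 \<and> \<bar>z - g u\<bar> = 1"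
      proof (cases "\<exists>u\<in>S. (v, u) \<in> parcs G")
        case True
        then obtain u where u: "u \<in> S" "(v, u) \<in> parcs G" by blast
        then have uT: "u \<in> ?T" using no_loops' by auto
        obtain y where y: "int (\<phi> v) = y mod 3 + 1" "\<bar>y - h u\<bar> = 1"
          using extend_lift[OF col(1)[OF vG]] hg[OF uT] ne(1)[OF u(2)] by blast
        obtain z where z: "int (\<psi> v) = z mod 3 + 1" "\<bar>z - g u\<bar> = 1"
          using extend_lift[OF col(2)[OF vG]] hg[OF uT] ne(2)[OF u(2)] by blast
        have "even (y - z)"
        proof -
          have "even (h u - g u)" using hg[OF uT] by blast
          moreover have "y - h u = 1 \<or> y - h u = -1" "z - g u = 1 \<or> z - g u = -1" using y z by auto
          ultimately show ?thesis by presburger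
        qed
        then show ?thesis using that y z leaf[OF _ u(1) _ u(2)] by metis
      next
        case False
        \<comment> \<open>Without a neighbour the heights are free; adding 3 flips the parity and
          keeps the residue.\<close>
        define y z where "y = int (\<phi> v) - 1" and "z = (if even (y - (int (\<psi> v) - 1)) then int (\<psi> v) - 1 else int (\<psi> v) + 2)"
        have "even (y - z)" by (auto simp: z_def)
        then show ?thesis using that[of y z] False col[OF vG] by (auto simp: y_def z_def)
      qed
      let ?h = "h(v := y)" and ?g = "g(v := z)"
      have "\<forall>w\<in>S. int (\<phi> w) = ?h w mod 3 + 1 \<and> int (\<psi> w) = ?g w mod 3 + 1 \<and> even (?h w - ?g w)"
        using hg yz(1-3) by auto
      moreover have "\<bar>?h u - ?h w\<bar> = 1 \<and> \<bar>?g u - ?g w\<bar> = 1"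
        if uw: "u \<in> S" "w \<in> S" "(u, w) \<in> parcs G" for u w
        using uw adj[of u w] yz(4)[of u] yz(4)[of w] arcs_symmetric[OF uw(3)] no_loops'[OF uw(3)]
        by (cases "u = v"; cases "w = v") (auto simp: abs_minus_commute)
      ultimately show ?thesis by blast
    qed simp
  qed
  from this[OF order_refl] obtain h g where
    "\<forall>v\<in>pverts G. int (\<phi> v) = h v mod 3 + 1 \<and> int (\<psi> v) = g v mod 3 + 1 \<and> even (h v - g v)"
    "\<forall>u\<in>pverts G. \<forall>v\<in>pverts G. (u, v) \<in> parcs G \<longrightarrow> \<bar>h u - h v\<bar> = (1::int) \<and> \<bar>g u - g v\<bar> = (1::int)"
    by blast
  then have "lift G \<phi> h" "lift G \<psi> g" "\<forall>v\<in>pverts G. even (h v - g v)"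
    using wellformed' by (auto simp: lift_def)
  then show ?thesis by blast
qed

text \<open>A set that no arc leaves contains everything reachable from its points, and by symmetry
  this includes \<open>r\<close> and then its whole component.\<close>

lemma component_linked:
  assumes "sym E"
  shows "linked E (E\<^sup>* `` {r})"
  unfolding linked_def
proof (intro allI impI, elim conjE)
  fix S assume S: "S \<subseteq> E\<^sup>* `` {r}" "S \<noteq> {}" "S \<noteq> E\<^sup>* `` {r}"
  show "\<exists>a\<in>S. \<exists>b\<in>E\<^sup>* `` {r} - S. (a, b) \<in> E"
  proof (rule ccontr)
    assume no: "\<not> ?thesis"
    have closed: "b \<in> S" if "a \<in> S" "(a, b) \<in> E" for a b
      using that S(1) no by (meson DiffI Image_singleton_iff rtrancl.rtrancl_into_rtrancl subsetD)
    obtain s where s: "s \<in> S" using S(2) by blast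
    have reach: "w \<in> S" if "(s, w) \<in> E\<^sup>*" for w
      using that by (induction rule: rtrancl_induct) (auto intro: s closed)
    have "(s, r) \<in> E\<^sup>*" using S(1) s sym_rtrancl[OF assms] by (auto dest: symD)
    then have "E\<^sup>* `` {r} \<subseteq> S" using reach by (auto intro: rtrancl_trans)
    then show False using S(1,3) by blast
  qed
qed

section \<open>The diameter\<close>

text \<open>A connected set spans at least \<open>card C - 1\<close> edges, and \<open>mad\<close>
  allows at most \<open>(1 - \<epsilon> / 2) * card C\<close>; together
  \<open>\<epsilon> * card C \<le> 2\<close>.\<close>

lemma linked_card_bound:
  assumes "pair_graph G" "mad G \<le> 2 - \<epsilon>" "0 < \<epsilon>" and M: "int M = \<lfloor>2 / \<epsilon>\<rfloor>"
    and C: "C \<subseteq> pverts G" "linked (parcs G) C"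
  shows "card C \<le> M"
proof (cases "C = {}")
  case False
  then obtain r where r: "r \<in> C" by blast
  interpret pair_graph G by fact
  have fin: "finite C" using C(1) pair_finite_verts finite_subset by blast
  have "2 * real (card (edges_within G C)) \<le> mad G * real (card C)"
    by (rule edges_within_le_mad[OF assms(1) C(1) False])
  also have "\<dots> \<le> (2 - \<epsilon>) * real (card C)"
    using assms(2) by (rule mult_right_mono) simp
  finally have "2 * real (card (edges_within G C)) \<le> (2 - \<epsilon>) * real (card C)" .
  moreover have "card C \<le> card (edges_within G C) + 1"
    by (rule linked_card_le[OF pair_finite_arcs fin C(2) r])
  then have "2 * real (card C) \<le> 2 * real (card (edges_within G C)) + 2" by simp
  ultimately have "\<epsilon> * real (card C) \<le> 2" by (simp add: left_diff_distrib)
  then have "real (card C) \<le> 2 / \<epsilon>" using assms(3) by (simp add: field_simps)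
  then have "int (card C) \<le> \<lfloor>2 / \<epsilon>\<rfloor>" by (simp add: le_floor_iff)
  then show ?thesis using M by simp
qed simp

lemma linked_shift:
  assumes "finite C" "linked E C" "card C \<le> M" "\<And>u v. (u, v) \<in> E \<Longrightarrow> \<bar>d u - d v\<bar> \<le> (1::int)"
  shows "\<exists>k. real_of_int (\<Sum>v\<in>C. \<bar>d v - 3 * k\<bar>) \<le> rho M * real (card C)"
proof -
  obtain x where x: "gentle (card C) x" "\<And>t. (\<Sum>v\<in>C. \<bar>d v - t\<bar>) = (\<Sum>i<card C. \<bar>x i - t\<bar>)"
    using linked_values_gentle[OF assms(1,2), of d] assms(4) by blast
  show ?thesis unfolding x(2) by (rule gentle_rho[OF x(1) assms(3)])
qed

lemma short_awalk:
  assumes "pair_graph G" "mad G \<le> 2 - \<epsilon>" "0 < \<epsilon>" and M: "int M = \<lfloor>2 / \<epsilon>\<rfloor>"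
    and phi: "\<phi> \<in> proper_3_colorings G" and psi: "\<psi> \<in> proper_3_colorings G"
  shows "\<exists>p. pre_digraph.awalk (with_proj (reconfiguration_graph G)) \<phi> p \<psi> \<and>
    real (length p) \<le> rho M * real (card (pverts G))"
proof -
  interpret pair_graph G by fact
  have "mad G < 2" using assms(2,3) by simp
  then obtain h g where h: "lift G \<phi> h" and g: "lift G \<psi> g"
    and par: "\<And>v. v \<in> pverts G \<Longrightarrow> even (h v - g v)"
    using exists_lifts[OF assms(1) _ phi psi] by blast
  have adj: "\<bar>h u - h v\<bar> = 1" "\<bar>g u - g v\<bar> = 1" if "(u, v) \<in> parcs G" for u v
    using h g that by (auto simp: lift_def)
  \<comment> \<open>Along an arc both heights change by 1 in absolute value, so their halved
    difference changes by at most 1.\<close>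
  define d where "d v = (h v - g v) div 2" for v
  have d: "h v - g v = 2 * d v" if "v \<in> pverts G" for v using par[OF that] by (simp add: d_def)
  have lip: "\<bar>d u - d v\<bar> \<le> 1" if uv: "(u, v) \<in> parcs G" for u v
    using adj[OF uv] d[of u] d[of v] wellformed'[OF uv] by linarith
  have sym: "sym (parcs G)" using arcs_symmetric by (auto intro: symI)
  define cl where "cl v = (parcs G)\<^sup>* `` {v}" for v
  have cl_sub: "cl v \<subseteq> pverts G" if "v \<in> pverts G" for v
  proof
    fix w assume "w \<in> cl v"
    then have "(v, w) \<in> (parcs G)\<^sup>*" by (simp add: cl_def)
    then show "w \<in> pverts G" by (induction rule: rtrancl_induct) (use that wellformed' in auto)
  qed
  have cl_eq: "cl v = cl w" if "w \<in> cl v" for v w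
    using that sym_rtrancl[OF sym] unfolding cl_def by (auto dest: symD intro: rtrancl_trans)
  have self: "v \<in> cl v" for v by (simp add: cl_def)
  \<comment> \<open>One good multiple of 3 is chosen for each component independently.\<close>
  define K where "K C = (SOME k. real_of_int (\<Sum>v\<in>C. \<bar>d v - 3 * k\<bar>) \<le> rho M * real (card C))" for C
  have K: "real_of_int (\<Sum>v\<in>C. \<bar>d v - 3 * K C\<bar>) \<le> rho M * real (card C)" if "C \<in> cl ` pverts G" for C
  proof -
    obtain r where r: "r \<in> pverts G" "C = cl r" using \<open>C \<in> cl ` pverts G\<close> by blast
    have link: "linked (parcs G) C" unfolding r(2) cl_def by (rule component_linked[OF sym])
    have sub: "C \<subseteq> pverts G" using cl_sub r by blast
    have "\<exists>k. real_of_int (\<Sum>v\<in>C. \<bar>d v - 3 * k\<bar>) \<le> rho M * real (card C)"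
      by (rule linked_shift[OF finite_subset[OF sub pair_finite_verts] link
            linked_card_bound[OF assms(1-4) sub link]]) (rule lip)
    then show ?thesis unfolding K_def by (rule someI_ex)
  qed
  \<comment> \<open>A shift by a multiple of 6 keeps colour and parity, and being constant on
    components it keeps the differences along arcs. It lowers the halved difference by
    \<open>3 * K (cl v)\<close>.\<close>
  define g' where "g' v = g v + 6 * K (cl v)" for v
  have cl_arc: "cl u = cl v" if "(u, v) \<in> parcs G" for u v
    using cl_eq[of v u] that by (auto simp: cl_def)
  have g': "lift G \<psi> g'"
    using g cl_arc unfolding lift_def g'_def by (auto simp: mod_add_eq[symmetric])
  have "even (h v - g' v)" if "v \<in> pverts G" for v
    using d[OF that] by (simp add: g'_def algebra_simps)
  then obtain p where p: "pre_digraph.awalk (with_proj (reconfiguration_graph G)) \<phi> p \<psi>"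
    "2 * int (length p) = (\<Sum>v\<in>pverts G. \<bar>h v - g' v\<bar>)"
    using awalk_between_lifts[OF assms(1) phi psi h g'] by blast
  have "\<bar>h v - g' v\<bar> = 2 * \<bar>d v - 3 * K (cl v)\<bar>" if "v \<in> pverts G" for v
    using d[OF that] by (simp add: g'_def abs_if)
  then have "(\<Sum>v\<in>pverts G. \<bar>h v - g' v\<bar>) = 2 * (\<Sum>v\<in>pverts G. \<bar>d v - 3 * K (cl v)\<bar>)"
    by (simp add: sum_distrib_left)
  then have "int (length p) = (\<Sum>v\<in>pverts G. \<bar>d v - 3 * K (cl v)\<bar>)"
    using p(2) by simp
  have fibre: "{v \<in> pverts G. cl v = C} = C" if "C \<in> cl ` pverts G" for C
    using that cl_eq cl_sub self by blast
  have split: "sum f (pverts G) = (\<Sum>C\<in>cl ` pverts G. sum f C)" for f :: "'a \<Rightarrow> 'c::comm_monoid_add"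
    using sum.image_gen[OF pair_finite_verts, of f cl] fibre by simp
  have "real (length p) = real_of_int (\<Sum>v\<in>pverts G. \<bar>d v - 3 * K (cl v)\<bar>)"
    using \<open>int (length p) = _\<close> by linarith
  also have "\<dots> = (\<Sum>C\<in>cl ` pverts G. real_of_int (\<Sum>v\<in>C. \<bar>d v - 3 * K (cl v)\<bar>))"
    unfolding split by simp
  also have "\<dots> = (\<Sum>C\<in>cl ` pverts G. real_of_int (\<Sum>v\<in>C. \<bar>d v - 3 * K C\<bar>))"
  proof (rule sum.cong[OF refl])
    fix C assume "C \<in> cl ` pverts G"
    then have "cl v = C" if "v \<in> C" for v using fibre that by blast
    then have "(\<Sum>v\<in>C. \<bar>d v - 3 * K (cl v)\<bar>) = (\<Sum>v\<in>C. \<bar>d v - 3 * K C\<bar>)" by simp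
    then show "real_of_int (\<Sum>v\<in>C. \<bar>d v - 3 * K (cl v)\<bar>) = real_of_int (\<Sum>v\<in>C. \<bar>d v - 3 * K C\<bar>)"
      by simp
  qed
  also have "\<dots> \<le> (\<Sum>C\<in>cl ` pverts G. rho M * real (card C))"
    by (rule sum_mono) (rule K)
  also have "\<dots> = rho M * real (\<Sum>C\<in>cl ` pverts G. card C)"
    by (simp add: sum_distrib_left)
  also have "(\<Sum>C\<in>cl ` pverts G. card C) = card (pverts G)"
    using split[of "\<lambda>_. 1::nat"] by simp
  finally show ?thesis using p(1) by blast
qed

lemma awalk_cost_one:
  fixes G :: "('a, 'b) pre_digraph" and p :: "'b list"
  assumes "wf_digraph G"
  shows "wf_digraph.awalk_cost (\<lambda>_. 1) p = real (length p)"
proof -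
  interpret wf_digraph G by fact
  show ?thesis by (induction p) simp_all
qed

lemma diameter_le:
  assumes "pair_graph G" "mad G \<le> 2 - \<epsilon>" "0 < \<epsilon>" and M: "int M = \<lfloor>2 / \<epsilon>\<rfloor>"
  shows "graph_diameter (reconfiguration_graph G) \<le> ereal (rho M * real (card (pverts G)))"
  unfolding graph_diameter_def
proof (intro SUP_least)
  fix \<phi> \<psi> assume "\<phi> \<in> pverts (reconfiguration_graph G)" "\<psi> \<in> pverts (reconfiguration_graph G)"
  then have "\<phi> \<in> proper_3_colorings G" "\<psi> \<in> proper_3_colorings G"
    by (simp_all add: reconfiguration_graph_def)
  then obtain p where p: "pre_digraph.awalk (with_proj (reconfiguration_graph G)) \<phi> p \<psi>"
    "real (length p) \<le> rho M * real (card (pverts G))"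
    using short_awalk[OF assms] by blast
  have "wf_digraph.\<mu> (with_proj (reconfiguration_graph G)) (\<lambda>_. 1) \<phi> \<psi> \<le> ereal (real (length p))"
    using wf_digraph.min_cost_le_walk_cost[OF wf_reconfiguration_graph[OF assms(1)] p(1), of "\<lambda>_. 1"]
    by (simp add: awalk_cost_one[OF wf_reconfiguration_graph[OF assms(1)]])
  also have "\<dots> \<le> ereal (rho M * real (card (pverts G)))" using p(2) by simp
  finally show "wf_digraph.\<mu> (with_proj (reconfiguration_graph G)) (\<lambda>_. 1) \<phi> \<psi>
    \<le> ereal (rho M * real (card (pverts G)))" .
qed

section \<open>The lower bound from disjoint paths\<close>

text \<open>
  \<open>k\<close> disjoint paths on \<open>m\<close> vertices each: the \<open>b\<close>-th path runs through \<open>b * m, \<dots>, b * m + m - 1\<close>.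
\<close>

definition path_copies :: "nat \<Rightarrow> nat \<Rightarrow> nat pair_pre_digraph" where
  "path_copies k m = \<lparr>pverts = {..<k * m},
     parcs = {(i, j). i < k * m \<and> j < k * m \<and> (j = Suc i \<or> i = Suc j) \<and> i div m = j div m}\<rparr>"

lemma pair_graph_path_copies: "pair_graph (path_copies k m)"
proof -
  have "finite (parcs (path_copies k m))"
    by (rule finite_subset[of _ "{..<k * m} \<times> {..<k * m}"]) (auto simp: path_copies_def)
  then show ?thesis
    by unfold_locales (auto simp: path_copies_def symmetric_def sym_def)
qed

text \<open>Charge each edge to its larger end, which is never the first vertex of \<open>S\<close>
  in its block. So there are at most \<open>card S - card L\<close> edges, and
  \<open>card S \<le> m * card L\<close> because a block has \<open>m\<close> vertices.\<close>

lemma mult_card_edges_path_copies_le: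
  assumes "m \<ge> 1" "finite S"
  shows "m * card (edges_within (path_copies k m) S) \<le> (m - 1) * card S"
proof -
  define L where "L = {v \<in> S. \<forall>w\<in>S. w div m = v div m \<longrightarrow> v \<le> w}"
  let ?E = "edges_within (path_copies k m) S"
  have form: "\<exists>i. e = {i, Suc i} \<and> i \<in> S \<and> Suc i \<in> S \<and> i div m = Suc i div m" if "e \<in> ?E" for e
    using that by (auto simp: edges_within_def path_copies_def)
  have "card ?E \<le> card (S - L)"
  proof (rule card_inj_on_le[of Max])
    show "inj_on Max ?E"
    proof (rule inj_onI)
      fix e f assume "e \<in> ?E" "f \<in> ?E" "Max e = Max f"
      then show "e = f" using form[of e] form[of f] by auto
    qed
    show "Max ` ?E \<subseteq> S - L"
    proof (rule image_subsetI)
      fix e assume "e \<in> ?E"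
      then obtain i where i: "e = {i, Suc i}" "i \<in> S" "Suc i \<in> S" "i div m = Suc i div m" using form by blast
      then have "Suc i \<notin> L" by (auto simp: L_def)
      then show "Max e \<in> S - L" using i by simp
    qed
  qed (use assms in simp)
  also have "card (S - L) = card S - card L"
    by (rule card_Diff_subset) (auto simp: L_def assms(2))
  finally have E: "card ?E \<le> card S - card L" .
  have "(\<lambda>v. v div m) ` S \<subseteq> (\<lambda>v. v div m) ` L"
  proof (rule image_subsetI)
    fix v assume v: "v \<in> S"
    let ?B = "{w \<in> S. w div m = v div m}"
    have B: "finite ?B" "?B \<noteq> {}" using assms(2) v by auto
    then have "Min ?B \<in> ?B" by (rule Min_in)
    moreover have "Min ?B \<in> L" using \<open>Min ?B \<in> ?B\<close> B by (auto simp: L_def)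
    ultimately show "v div m \<in> (\<lambda>v. v div m) ` L" by (intro image_eqI[of _ _ "Min ?B"]) auto
  qed
  then have "card ((\<lambda>v. v div m) ` S) \<le> card ((\<lambda>v. v div m) ` L)"
    by (rule card_mono[rotated]) (simp add: L_def assms(2))
  also have "\<dots> \<le> card L" by (rule card_image_le) (simp add: L_def assms(2))
  finally have blocks: "card ((\<lambda>v. v div m) ` S) \<le> card L" .
  have "S \<subseteq> (\<Union>b\<in>(\<lambda>v. v div m) ` S. {b * m..<b * m + m})"
  proof
    fix v assume v: "v \<in> S"
    have "v div m * m + v mod m = v" "v mod m < m" using assms(1) by simp_all
    then have "v div m * m \<le> v" "v < v div m * m + m" by linarith+
    then show "v \<in> (\<Union>b\<in>(\<lambda>v. v div m) ` S. {b * m..<b * m + m})"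
      by (intro UN_I[of "v div m"] imageI v) simp
  qed
  then have "card S \<le> card (\<Union>b\<in>(\<lambda>v. v div m) ` S. {b * m..<b * m + m})"
    by (rule card_mono[rotated]) (simp add: assms(2))
  also have "\<dots> \<le> (\<Sum>b\<in>(\<lambda>v. v div m) ` S. card {b * m..<b * m + m})"
    by (rule card_UN_le) (simp add: assms(2))
  also have "\<dots> = m * card ((\<lambda>v. v div m) ` S)" by simp
  also have "\<dots> \<le> m * card L" using blocks by simp
  finally have L: "card S \<le> m * card L" .
  have "m * card ?E \<le> m * card S - m * card L"
    using mult_le_mono2[OF E, of m] by (simp add: diff_mult_distrib2)
  also have "\<dots> \<le> m * card S - card S" using L by simp
  finally show ?thesis by (simp add: diff_mult_distrib)
qed

lemma mad_path_copies_le: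
  assumes "m \<ge> 1" "k \<ge> 1"
  shows "mad (path_copies k m) \<le> 2 - 2 / real m"
proof (rule mad_leI[OF pair_graph_path_copies])
  have "0 < k * m" using assms by simp
  then have "0 \<in> pverts (path_copies k m)" by (simp add: path_copies_def)
  then show "pverts (path_copies k m) \<noteq> {}" by blast
next
  fix S assume "S \<subseteq> pverts (path_copies k m)"
  then have "finite S" by (auto simp: path_copies_def intro: finite_subset)
  then have "m * card (edges_within (path_copies k m) S) \<le> (m - 1) * card S"
    by (rule mult_card_edges_path_copies_le[OF assms(1)])
  then have "real (m * card (edges_within (path_copies k m) S)) \<le> real ((m - 1) * card S)"
    by (simp only: of_nat_le_iff)
  then have "real m * real (card (edges_within (path_copies k m) S)) \<le> (real m - 1) * real (card S)"
    using assms(1) by (simp add: of_nat_diff)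
  then show "2 * real (card (edges_within (path_copies k m) S)) \<le> (2 - 2 / real m) * real (card S)"
    using assms(1) by (simp add: field_simps)
qed

lemma sum_blocks:
  fixes f :: "nat \<Rightarrow> 'b::comm_monoid_add"
  shows "(\<Sum>i<k * m. f i) = (\<Sum>b<k. \<Sum>j<m. f (b * m + j))"
proof (induction k)
  case (Suc k)
  have "(\<Sum>i<Suc k * m. f i) = (\<Sum>i<k * m + m. f i)" by (simp add: add.commute)
  then show ?case using Suc by (simp only: sum_lessThan_add sum.lessThan_Suc)
qed simp

text \<open>\<open>6 * (c - c')\<close> is a difference of two numbers from {1, -1}, too small
  unless it is 0.\<close>

lemma eq_of_shift_six:
  fixes x y c c' :: int
  assumes "\<bar>x - y\<bar> = 1" "\<bar>(x + 6 * c) - (y + 6 * c')\<bar> = 1"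
  shows "c = c'"
proof -
  have one: "u = 1 \<or> u = -1" if "\<bar>u\<bar> = 1" for u :: int using that by linarith
  have "6 * (c - c') = (x + 6 * c) - (y + 6 * c') - (x - y)" by simp
  then have "6 * (c - c') \<in> {0, 2, -2}" using one[OF assms(1)] one[OF assms(2)] by auto
  then show ?thesis by auto
qed

text \<open>The two lifts agree modulo 3 by colour and modulo 2 by parity, hence modulo 6; the
  multiple of 6 cannot change along an edge, so it is constant on a path.\<close>

lemma lifts_differ_by_constant:
  assumes lift: "lift (path_copies k m) \<psi> g" "lift (path_copies k m) \<psi> g'"
    and par: "\<And>v. v < k * m \<Longrightarrow> even (g v - g' v)" and b: "b < k"
  shows "\<exists>c. \<forall>j<m. g' (b * m + j) = g (b * m + j) + 6 * c"
proof (cases "m = 0")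
  case False
  have "b * m + m \<le> k * m" using mult_le_mono1[of "Suc b" k m] b by simp
  then have V: "b * m + j < k * m" if "j < m" for j using that by linarith
  have six: "\<exists>c. g' v = g v + 6 * c" if "v < k * m" for v
  proof -
    have "g v mod 3 = g' v mod 3"
      using lift that by (auto simp: lift_def path_copies_def)
    then have "\<exists>c. g' v = g v + 6 * c" using par[OF that] by presburger
    then show ?thesis .
  qed
  obtain c where c: "g' (b * m) = g (b * m) + 6 * c" using six[of "b * m"] V[of 0] False by auto
  have "g' (b * m + j) = g (b * m + j) + 6 * c" if "j < m" for j
    using that
  proof (induction j)
    case 0
    then show ?case using c by simp
  next
    case (Suc j)
    let ?v = "b * m + j"
    have "(?v, Suc ?v) \<in> parcs (path_copies k m)"
      using V[of j] V[of "Suc j"] Suc.prems by (simp add: path_copies_def div_mult_self1 flip: add_Suc_right)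
    then have "\<bar>g ?v - g (Suc ?v)\<bar> = 1" "\<bar>g' ?v - g' (Suc ?v)\<bar> = 1"
      using lift by (auto simp: lift_def)
    moreover obtain c' where c': "g' (Suc ?v) = g (Suc ?v) + 6 * c'"
      using six[of "Suc ?v"] V[of "Suc j"] Suc.prems by auto
    moreover have "g' ?v = g ?v + 6 * c" using Suc by simp
    ultimately have "c = c'" using eq_of_shift_six by metis
    then show ?case using c' by simp
  qed
  then show ?thesis by blast
qed simp

lemma lift_path_copiesI:
  assumes "\<And>j. Suc j < m \<Longrightarrow> \<bar>h (Suc j) - h j\<bar> = 1" "m \<ge> 1"
  shows "lift (path_copies k m) (\<lambda>v\<in>{..<k * m}. nat (h (v mod m) mod 3 + 1)) (\<lambda>v. h (v mod m))"
  unfolding lift_def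
proof (intro conjI ballI, goal_cases)
  case (1 v)
  then show ?case by (simp add: path_copies_def)
next
  case (2 a)
  have step: "\<bar>h (Suc i mod m) - h (i mod m)\<bar> = 1" if "i div m = Suc i div m" for i
  proof -
    have "i div m * m + Suc i mod m = Suc (i div m * m + i mod m)"
      unfolding div_mult_mod_eq by (simp add: that)
    then have "Suc i mod m = Suc (i mod m)" by (metis add_Suc_right add_left_cancel)
    moreover have "Suc i mod m < m" using assms(2) by simp
    ultimately show ?thesis using assms(1)[of "i mod m"] by simp
  qed
  obtain i j where a: "a = (i, j)" by (cases a)
  then have "j = Suc i \<or> i = Suc j" "i div m = j div m" using 2 by (auto simp: path_copies_def)
  then have "\<bar>h (i mod m) - h (j mod m)\<bar> = 1" using step[of i] step[of j] by (auto simp: abs_minus_commute)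
  then show ?case by (simp add: a)
qed

lemma diameter_path_copies_ge:
  assumes m: "m \<ge> 1"
    and rho: "4 * rho M * real m = (if odd m then real m ^ 2 + 3 else real m ^ 2 + 8)"
  shows "graph_diameter (reconfiguration_graph (path_copies k m)) \<ge> ereal (rho M * real (k * m))"
proof -
  let ?G = "path_copies k m"
  \<comment> \<open>One colouring climbs and the other descends along each path, so the halved
    height difference at position \<open>j\<close> is \<open>j + a\<close>: the window of
    \<open>sum_abs_central\<close>.\<close>
  define a where "a = 1 - int ((m - 1) div 2)"
  define h0 g0 where "h0 j = int j + 2 * a" and "g0 j = - int j" for j :: nat
  define h g where "h v = h0 (v mod m)" and "g v = g0 (v mod m)" for v
  define \<phi> \<psi> where "\<phi> = (\<lambda>v\<in>{..<k * m}. nat (h0 (v mod m) mod 3 + 1))"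
    and "\<psi> = (\<lambda>v\<in>{..<k * m}. nat (g0 (v mod m) mod 3 + 1))"
  have h: "lift ?G \<phi> h" and g: "lift ?G \<psi> g"
    unfolding \<phi>_def \<psi>_def h_def g_def by (rule lift_path_copiesI; use m in \<open>simp add: h0_def g0_def\<close>)+
  have phi: "\<phi> \<in> pverts (reconfiguration_graph ?G)"
    using lift_imp_proper[OF pair_graph_path_copies h]
    by (simp add: reconfiguration_graph_def \<phi>_def path_copies_def)
  have psi: "\<psi> \<in> pverts (reconfiguration_graph ?G)"
    using lift_imp_proper[OF pair_graph_path_copies g]
    by (simp add: reconfiguration_graph_def \<psi>_def path_copies_def)
  have len: "rho M * real (k * m) \<le> real (length p)"
    if p: "pre_digraph.awalk (with_proj (reconfiguration_graph ?G)) \<phi> p \<psi>" for p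
  proof -
    \<comment> \<open>Following the walk from \<open>h\<close> ends in some lift of
      \<open>\<psi>\<close>, which on each path is \<open>g\<close> shifted by a multiple of
      6.\<close>
    obtain g' where g': "lift ?G \<psi> g'" "(\<Sum>v\<in>pverts ?G. \<bar>h v - g' v\<bar>) \<le> 2 * int (length p)"
        "\<And>v. even (h v - g' v)"
      using lift_along_awalk[OF pair_graph_path_copies h p] by blast
    have "even (h v - g v)" for v by (simp add: h_def g_def h0_def g0_def)
    then have par: "even (g v - g' v)" for v using g'(3)[of v] by (metis even_diff even_add)
    \<comment> \<open>By \<open>sum_abs_shift_lower\<close>, \<open>D\<close> is at most four times
      the sum of halved differences on one path, whatever the shift.\<close>
    define D where "D = (if odd m then int m ^ 2 + 3 else int m ^ 2 + 8)"
    have block: "2 * (\<Sum>j<m. \<bar>h (b * m + j) - g' (b * m + j)\<bar>) \<ge> D" if b: "b < k" for b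
    proof -
      obtain c where c: "\<And>j. j < m \<Longrightarrow> g' (b * m + j) = g (b * m + j) + 6 * c"
        using lifts_differ_by_constant[OF g g'(1) par b] by blast
      have "(\<Sum>j<m. \<bar>h (b * m + j) - g' (b * m + j)\<bar>) = (\<Sum>j<m. 2 * \<bar>int j + a + 3 * (- c)\<bar>)"
      proof (rule sum.cong[OF refl])
        fix j assume "j \<in> {..<m}"
        then have "h (b * m + j) - g' (b * m + j) = 2 * (int j + a + 3 * (- c))"
          by (simp add: c h_def g_def h0_def g0_def)
        then show "\<bar>h (b * m + j) - g' (b * m + j)\<bar> = 2 * \<bar>int j + a + 3 * (- c)\<bar>"
          by (simp only: abs_mult abs_numeral)
      qed
      also have "\<dots> = 2 * (\<Sum>j<m. \<bar>int j + a + 3 * (- c)\<bar>)" by (simp add: sum_distrib_left)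
      finally show ?thesis using sum_abs_shift_lower[OF m, of "- c"] unfolding D_def a_def by linarith
    qed
    have "int k * D = (\<Sum>b<k. D)" by simp
    also have "\<dots> \<le> (\<Sum>b<k. 2 * (\<Sum>j<m. \<bar>h (b * m + j) - g' (b * m + j)\<bar>))"
      by (rule sum_mono) (use block in simp)
    also have "\<dots> = 2 * (\<Sum>v<k * m. \<bar>h v - g' v\<bar>)" by (simp add: sum_blocks sum_distrib_left)
    also have "\<dots> \<le> 4 * int (length p)" using g'(2) by (simp add: path_copies_def)
    finally have "real_of_int (int k * D) \<le> real_of_int (4 * int (length p))" by (simp only: of_int_le_iff)
    then have "real k * real_of_int D \<le> 4 * real (length p)" by simp
    moreover have "real_of_int D = 4 * rho M * real m" unfolding rho D_def by simp
    ultimately show ?thesis by (simp add: algebra_simps)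
  qed
  have "ereal (rho M * real (k * m)) \<le> wf_digraph.\<mu> (with_proj (reconfiguration_graph ?G)) (\<lambda>_. 1) \<phi> \<psi>"
    unfolding wf_digraph.\<mu>_def[OF wf_reconfiguration_graph[OF pair_graph_path_copies]]
    by (rule INF_greatest) (simp add: awalk_cost_one[OF wf_reconfiguration_graph[OF pair_graph_path_copies]] len del: of_nat_mult)
  also have "\<dots> \<le> graph_diameter (reconfiguration_graph ?G)"
    unfolding graph_diameter_def by (rule SUP_upper2[OF phi]) (rule SUP_upper[OF psi])
  finally show ?thesis .
qed

theorem theorem1p4:
  fixes \<epsilon> :: real and M :: nat
  assumes "0 < \<epsilon>" and "\<epsilon> < 2"
    and "int M = \<lfloor>2 / \<epsilon>\<rfloor>"
  shows "(\<forall>(G :: 'a pair_pre_digraph) n.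
            pair_graph G \<and> card (pverts G) = n \<and> 1 \<le> n \<and> mad G \<le> 2 - \<epsilon> \<longrightarrow>
            graph_diameter (reconfiguration_graph G) \<le> ereal (rho M * real n)) \<and>
         infinite {n. \<exists>G :: nat pair_pre_digraph.
            pair_graph G \<and> card (pverts G) = n \<and> 1 \<le> n \<and> mad G \<le> 2 - \<epsilon> \<and>
            graph_diameter (reconfiguration_graph G) = ereal (rho M * real n)}"
    (is "_ \<and> infinite ?N")
proof
  show "\<forall>(G :: 'a pair_pre_digraph) n.
            pair_graph G \<and> card (pverts G) = n \<and> 1 \<le> n \<and> mad G \<le> 2 - \<epsilon> \<longrightarrow>
            graph_diameter (reconfiguration_graph G) \<le> ereal (rho M * real n)"
    using diameter_le[OF _ _ assms(1,3)] by blast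
  have "1 \<le> 2 / \<epsilon>" using assms(1,2) by simp
  then have "1 \<le> int M" unfolding assms(3) by (simp add: le_floor_iff)
  then have "M \<ge> 1" by simp
  then obtain m where m: "1 \<le> m" "m \<le> M"
    and rho: "4 * rho M * real m = (if odd m then real m ^ 2 + 3 else real m ^ 2 + 8)"
    by (rule rho_attained)
  \<comment> \<open>A path on \<open>m\<close> vertices has average degree \<open>2 - 2 / m\<close>,
    which is admissible because \<open>m \<le> 2 / \<epsilon>\<close>.\<close>
  have "real m \<le> real_of_int \<lfloor>2 / \<epsilon>\<rfloor>" using m(2) unfolding assms(3)[symmetric] by simp
  then have "real m \<le> 2 / \<epsilon>" by linarith
  then have "\<epsilon> \<le> 2 / real m" using m(1) assms(1) by (simp add: field_simps)
  \<comment> \<open>\<open>Suc k\<close> copies keep the graph nonempty. Upper and lower bound both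
    grow in proportion to the number of copies, so they meet for every \<open>k\<close>.\<close>
  have "Suc k * m \<in> ?N" for k
  proof -
    have "mad (path_copies (Suc k) m) \<le> 2 - \<epsilon>"
      using mad_path_copies_le[OF m(1), of "Suc k"] \<open>\<epsilon> \<le> 2 / real m\<close> by simp
    moreover have card: "card (pverts (path_copies (Suc k) m)) = Suc k * m"
      by (simp add: path_copies_def)
    ultimately have "graph_diameter (reconfiguration_graph (path_copies (Suc k) m)) = ereal (rho M * real (Suc k * m))"
      using diameter_le[OF pair_graph_path_copies _ assms(1,3), of "Suc k" m]
        diameter_path_copies_ge[OF m(1) rho, of "Suc k"]
      by (intro antisym) (simp_all only:)
    then show ?thesis
      using \<open>mad (path_copies (Suc k) m) \<le> 2 - \<epsilon>\<close> card pair_graph_path_copies[of "Suc k" m] m(1)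
      by (intro CollectI exI[of _ "path_copies (Suc k) m"]) simp
  qed
  then have "range (\<lambda>k. Suc k * m) \<subseteq> ?N" by blast
  moreover have "infinite (range (\<lambda>k. Suc k * m))"
    by (rule range_inj_infinite) (use m(1) in \<open>auto intro!: injI\<close>)
  ultimately show "infinite ?N" using finite_subset by blast
qed

end
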